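(* Let $(R,\mathfrak{m},K)$ be a Noetherian local ring or a standard graded $K$-algebra, and let $I\subset R$ be a proper ideal, assumed to be graded if $R$ is standard graded, with $\ell(I)=2$. Let $(h_0,h_1,h_2,\ldots)$ be the $h$-vector of $F(I)$. Then: (a) $\mu(I^2)\geq 2\mu(I)-1$ if and only if $h_2\geq 0$. (b) $\mu(I^k)\geq k(\mu(I)-1)+1$ for all $k\geq 1$, if $h_i\geq 0$ for all $i$. (c) $\mu(I^k)=k(\mu(I)-1)+1$ for all $k\geq 1$ if and only if $h_i=0$ for all $i\geq 2$.
   Context: Here $\mathfrak{m}$ is the (graded) maximal ideal of $R$ and $K=R/\mathfrak{m}$. $\mu(L)$ denotes the minimal number of generators of an ideal $L$ (graded if $R$ is standard graded). The fiber ring of $I$ is the standard graded $K$-algebra $F(I)=\bigoplus_{k\geq 0}I^k/\mathfrak{m}I^k$, and the analytic spread $\ell(I)$ is the Krull dimension of $F(I)$. The Hilbert series of $F(I)$ has the form $\sum_{k\geq0}\mu(I^k)t^k=Q(t)/(1-t)^{\ell(I)}$ with $Q(t)=\sum_{i\geq 0}h_it^i$ a polynomial with integer coefficients and $h_0=1$; $(h_0,h_1,\ldots)$ is called the $h$-vector of $F(I)$. *)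

theory Defs
  imports
    "HOL-Library.Extended_Nat"
    "HOL-Computational_Algebra.Formal_Power_Series"
    "HOL-Algebra.Embedded_Algebras"
    "HOL-Algebra.Generated_Rings"
    "HOL-Algebra.Ideal_Product"
    "HOL-Algebra.QuotRing"
    "HOL-Algebra.Ring_Divisibility"
begin

section \<open>The two kinds of base ring\<close>

locale noetherian_local_ring = cring R + noetherian_ring R for R (structure) +
  fixes \<mm> :: "'a set"
  assumes maximal: "maximalideal \<mm> R"
    and unique_maximal: "maximalideal M R \<Longrightarrow> M = \<mm>"

text \<open>\<open>f\<close> is the family of homogeneous components of \<open>x\<close> with respect to the family \<open>G\<close> of
  graded pieces.\<close>

definition homogeneous_decomp ::
    "('a, 'b) ring_scheme \<Rightarrow> (nat \<Rightarrow> 'a set) \<Rightarrow> 'a \<Rightarrow> (nat \<Rightarrow> 'a) \<Rightarrow> bool" where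
  "homogeneous_decomp R G x f \<longleftrightarrow>
     (\<forall>i. f i \<in> G i) \<and> finite {i. f i \<noteq> \<zero>\<^bsub>R\<^esub>} \<and>
     x = (\<Oplus>\<^bsub>R\<^esub>i\<in>{i. f i \<noteq> \<zero>\<^bsub>R\<^esub>}. f i)"

text \<open>The ground field of a standard graded algebra is the degree-zero piece \<open>G 0\<close>.\<close>

locale standard_graded_algebra = cring R for R (structure) +
  fixes G :: "nat \<Rightarrow> 'a set"
  assumes piece_subgroup: "additive_subgroup (G i) R"
    and mult_graded: "\<lbrakk> a \<in> G i; b \<in> G j \<rbrakk> \<Longrightarrow> a \<otimes> b \<in> G (i + j)"
    and direct_sum: "x \<in> carrier R \<Longrightarrow> \<exists>!f. homogeneous_decomp R G x f"
    and ground_field: "subfield (G 0) R"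
    and generated_in_degree_one:
      "\<exists>S. finite S \<and> S \<subseteq> G 1 \<and> carrier R = generate_ring R (G 0 \<union> S)"

definition graded_maximal_ideal ::
    "('a, 'b) ring_scheme \<Rightarrow> (nat \<Rightarrow> 'a set) \<Rightarrow> 'a set" where
  "graded_maximal_ideal R G = genideal R (\<Union>i\<in>{1..}. G i)"

definition graded_ideal ::
    "('a, 'b) ring_scheme \<Rightarrow> (nat \<Rightarrow> 'a set) \<Rightarrow> 'a set \<Rightarrow> bool" where
  "graded_ideal R G I \<longleftrightarrow>
     ideal I R \<and> (\<forall>x\<in>I. \<forall>f. homogeneous_decomp R G x f \<longrightarrow> (\<forall>i. f i \<in> I))"


section \<open>Generators and powers of ideals\<close>

text \<open>Meaningful for finitely generated ideals only. For a graded ideal of a standard graded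
  algebra, allowing inhomogeneous generators does not lower the minimum.\<close>

definition min_gens :: "('a, 'b) ring_scheme \<Rightarrow> 'a set \<Rightarrow> nat" where
  "min_gens R L =
     (LEAST n. \<exists>S. S \<subseteq> carrier R \<and> finite S \<and> card S = n \<and> genideal R S = L)"

definition ideal_power :: "('a, 'b) ring_scheme \<Rightarrow> 'a set \<Rightarrow> nat \<Rightarrow> 'a set" where
  "ideal_power R I k = I [^]\<^bsub>ideals_set R\<^esub> k"


section \<open>Krull dimension, Hilbert series and $h$-vector\<close>

definition krull_dim :: "('a, 'b) ring_scheme \<Rightarrow> enat" where
  "krull_dim R = Sup {enat n | n. \<exists>P :: nat \<Rightarrow> 'a set.
     (\<forall>i\<le>n. primeideal (P i) R) \<and> (\<forall>i<n. P i \<subset> P (Suc i))}"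

text \<open>The coefficients are the dimensions of the graded pieces over the field \<open>G 0\<close>.\<close>

definition hilbert_series :: "('a, 'b) ring_scheme \<Rightarrow> (nat \<Rightarrow> 'a set) \<Rightarrow> int fps" where
  "hilbert_series A G = Abs_fps (\<lambda>k. int (ring.dim A (G 0) (G k)))"

text \<open>The coefficients of the numerator \<open>Q\<close> in \<open>Q / (1 - t)\<^sup>d\<close>, with \<open>d\<close> the Krull dimension; this
  form of the Hilbert series determines \<open>Q\<close> as the power series \<open>(1 - t)\<^sup>d\<close> times the series. Meaningful
  for finite Krull dimension only.\<close>

definition h_vector :: "('a, 'b) ring_scheme \<Rightarrow> (nat \<Rightarrow> 'a set) \<Rightarrow> nat \<Rightarrow> int" where
  "h_vector A G i =
     fps_nth ((1 - fps_X) ^ the_enat (krull_dim A) * hilbert_series A G) i"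


section \<open>The fiber ring\<close>

definition fiber_kernel ::
    "('a, 'b) ring_scheme \<Rightarrow> 'a set \<Rightarrow> 'a set \<Rightarrow> nat \<Rightarrow> 'a set" where
  "fiber_kernel R \<mm> I k = \<mm> \<cdot>\<^bsub>R\<^esub> ideal_power R I k"

text \<open>The quotient of \<open>I\<^sup>k\<close> by \<open>\<mm> I\<^sup>k\<close>, as a set of cosets in the ring \<open>R Quot \<mm> I\<^sup>k\<close>.\<close>

definition fiber_summand ::
    "('a, 'b) ring_scheme \<Rightarrow> 'a set \<Rightarrow> 'a set \<Rightarrow> nat \<Rightarrow> 'a set set" where
  "fiber_summand R \<mm> I k =
     {fiber_kernel R \<mm> I k +>\<^bsub>R\<^esub> x | x. x \<in> ideal_power R I k}"

text \<open>The direct sum of these quotients: finitely supported families of cosets, the zero coset in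
  degree \<open>k\<close> being \<open>\<mm> I\<^sup>k\<close> itself. In degree \<open>n\<close> a product is the sum over \<open>i \<le> n\<close>, taken in
  \<open>R Quot \<mm> I\<^sup>n\<close>, of the classes modulo \<open>\<mm> I\<^sup>n\<close> of products of representatives in degrees \<open>i\<close> and
  \<open>n - i\<close>.\<close>

definition fiber_ring ::
    "('a, 'b) ring_scheme \<Rightarrow> 'a set \<Rightarrow> 'a set \<Rightarrow> (nat \<Rightarrow> 'a set) ring" where
  "fiber_ring R \<mm> I =
     \<lparr> carrier = {f. (\<forall>k. f k \<in> fiber_summand R \<mm> I k) \<and> finite {k. f k \<noteq> fiber_kernel R \<mm> I k}},
       mult = (\<lambda>f g n. \<Oplus>\<^bsub>R Quot fiber_kernel R \<mm> I n\<^esub>i\<in>{..n}.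
                 rcoset_mult R (fiber_kernel R \<mm> I n) (f i) (g (n - i))),
       one = (\<lambda>n. if n = 0 then fiber_kernel R \<mm> I 0 +>\<^bsub>R\<^esub> \<one>\<^bsub>R\<^esub> else fiber_kernel R \<mm> I n),
       zero = fiber_kernel R \<mm> I,
       add = (\<lambda>f g n. f n <+>\<^bsub>R\<^esub> g n) \<rparr>"

definition fiber_piece ::
    "('a, 'b) ring_scheme \<Rightarrow> 'a set \<Rightarrow> 'a set \<Rightarrow> nat \<Rightarrow> (nat \<Rightarrow> 'a set) set" where
  "fiber_piece R \<mm> I k =
     {f \<in> carrier (fiber_ring R \<mm> I). \<forall>j. j \<noteq> k \<longrightarrow> f j = fiber_kernel R \<mm> I j}"

definition analytic_spread :: "('a, 'b) ring_scheme \<Rightarrow> 'a set \<Rightarrow> 'a set \<Rightarrow> enat" where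
  "analytic_spread R \<mm> I = krull_dim (fiber_ring R \<mm> I)"

end

theory Submission
  imports Defs "HOL-Algebra.UnivPoly"
begin

text \<open>
  Write \<open>m k = \<mu>(I\<^sup>k)\<close>. As the analytic spread is two, \<open>h\<close> consists of the coefficients of \<open>(1 - t)\<^sup>2\<close> times the
  Hilbert series of the fiber ring. If the Hilbert function of the fiber ring is \<open>m\<close>, then
  \<open>h i = m i - 2 m (i - 1) + m (i - 2)\<close> for \<open>i \<ge> 2\<close>, and \<open>m 0 = 1\<close>. The three claims then concern the second
  differences of a sequence of integers: the first is the case \<open>i = 2\<close>, the second says that a convex
  sequence lies above the line through its first two values, and the third that a sequence is linear
  exactly if its second differences vanish (\<open>second_difference_bounds\<close>).

  What remains is the equality \<open>dim (I\<^sup>k / \<mm> I\<^sup>k) = \<mu>(I\<^sup>k)\<close> over the field \<open>R / \<mm>\<close> (\<open>dim_fiber_piece\<close>), where the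
  dimension is taken inside the fiber ring. The fiber ring is a ring, because it is the image of the Rees
  algebra, which is a subring of \<open>R[t]\<close> (\<open>ring_F\<close>); its degree zero piece is the field \<open>R / \<mm>\<close>; and
  the span of the classes of elements of \<open>I\<^sup>k\<close> consists of the classes of the ideal that they generate
  (\<open>Span_fiber_class\<close>). Generators of \<open>I\<^sup>k\<close> therefore give spanning sets, and Nakayama's lemma turns
  suitable bases back into generators.

  Nakayama's lemma has a local and a graded version (\<open>local_nakayama\<close>, \<open>graded_nakayama\<close>). The graded one
  needs homogeneous elements, so there the basis has to be selected from homogeneous
  generators. Finitely many of them exist because a standard graded algebra is Noetherian, by
  Hilbert's basis theorem (\<open>hilbert_basis\<close>) applied to one generator of the algebra after another.
\<close>

section \<open>Ideals and subrings\<close>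

text \<open>Negatives come for free: they are multiples by \<open>\<ominus> \<one>\<close>. Stated for a subring because the leading
  coefficients below form an ideal of the coefficient ring only.\<close>

lemma (in cring) ideal_of_subringI:
  assumes A: "subring A R" and sub: "H \<subseteq> A" and zero: "\<zero> \<in> H"
    and add: "\<And>a b. a \<in> H \<Longrightarrow> b \<in> H \<Longrightarrow> a \<oplus> b \<in> H"
    and mult: "\<And>a b. a \<in> A \<Longrightarrow> b \<in> H \<Longrightarrow> a \<otimes> b \<in> H"
  shows "ideal H (R\<lparr>carrier := A\<rparr>)"
proof (rule idealI)
  note subring_A = subringE[OF A]
  show "ring (R\<lparr>carrier := A\<rparr>)" by (rule subring_is_ring[OF A])
  have carr: "h \<in> carrier R" if "h \<in> H" for h using that sub subring_A(1) by blast
  have "subgroup H (add_monoid R)"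
  proof (rule add.subgroupI)
    fix h assume h: "h \<in> H"
    have "\<ominus> h = (\<ominus> \<one>) \<otimes> h" using carr[OF h] by (simp add: l_minus)
    then show "\<ominus> h \<in> H" using mult[OF _ h] subring_A(3,5) by metis
  qed (use carr zero add in auto)
  then have "subgroup H ((add_monoid R)\<lparr>carrier := A\<rparr>)"
    using add.subgroup_incl[OF _ subring.axioms(1)[OF A] sub] by blast
  then show "subgroup H (add_monoid (R\<lparr>carrier := A\<rparr>))" by simp
next
  fix a y assume ay: "a \<in> H" "y \<in> carrier (R\<lparr>carrier := A\<rparr>)"
  then have "a \<in> carrier R" "y \<in> carrier R" using sub subringE(1)[OF A] by auto
  with ay show "y \<otimes>\<^bsub>R\<lparr>carrier := A\<rparr>\<^esub> a \<in> H" "a \<otimes>\<^bsub>R\<lparr>carrier := A\<rparr>\<^esub> y \<in> H"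
    using mult[of y a] m_comm[of a y] by auto
qed

lemma (in cring) idealI_closed:
  assumes "H \<subseteq> carrier R" "\<zero> \<in> H"
    and "\<And>a b. a \<in> H \<Longrightarrow> b \<in> H \<Longrightarrow> a \<oplus> b \<in> H"
    and "\<And>a b. a \<in> carrier R \<Longrightarrow> b \<in> H \<Longrightarrow> a \<otimes> b \<in> H"
  shows "ideal H R"
  using ideal_of_subringI[OF carrier_is_subring assms] by simp

lemma (in ring) ideal_closed:
  assumes "ideal J R"
  shows "J \<subseteq> carrier R" "\<zero> \<in> J"
    and "\<And>a b. a \<in> J \<Longrightarrow> b \<in> J \<Longrightarrow> a \<oplus> b \<in> J"
    and "\<And>a. a \<in> J \<Longrightarrow> \<ominus> a \<in> J"
    and "\<And>a b. a \<in> J \<Longrightarrow> b \<in> J \<Longrightarrow> a \<ominus> b \<in> J"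
    and "\<And>a b. a \<in> carrier R \<Longrightarrow> b \<in> J \<Longrightarrow> a \<otimes> b \<in> J"
    and "\<And>a b. a \<in> J \<Longrightarrow> b \<in> carrier R \<Longrightarrow> a \<otimes> b \<in> J"
proof -
  interpret ideal J R by fact
  show "J \<subseteq> carrier R" "\<zero> \<in> J"
    and "\<And>a b. a \<in> J \<Longrightarrow> b \<in> J \<Longrightarrow> a \<oplus> b \<in> J"
    and "\<And>a. a \<in> J \<Longrightarrow> \<ominus> a \<in> J"
    and "\<And>a b. a \<in> J \<Longrightarrow> b \<in> J \<Longrightarrow> a \<ominus> b \<in> J"
    and "\<And>a b. a \<in> carrier R \<Longrightarrow> b \<in> J \<Longrightarrow> a \<otimes> b \<in> J"
    and "\<And>a b. a \<in> J \<Longrightarrow> b \<in> carrier R \<Longrightarrow> a \<otimes> b \<in> J"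
    using a_subset I_l_closed I_r_closed by (auto simp: a_minus_def)
qed

section \<open>Hilbert's basis theorem\<close>

text \<open>The \<open>A\<close>-span of \<open>x\<^sup>0, \<dots>, x\<^bsup>d - 1\<^esup>\<close>: values at \<open>x\<close> of the polynomials of degree below \<open>d\<close>. Working with
  these values inside \<open>R\<close>, instead of with a polynomial ring that maps onto \<open>R\<close>, lets \<open>x\<close> satisfy
  relations over \<open>A\<close>.\<close>

primrec (in ring) low_degree :: "'a set \<Rightarrow> 'a \<Rightarrow> nat \<Rightarrow> 'a set" where
  "low_degree A x 0 = {\<zero>}"
| "low_degree A x (Suc d) = line_extension A (x [^] d) (low_degree A x d)"

text \<open>An element of \<open>R\<close> may be the value of several polynomials, so it has no leading coefficient of its
  own; this collects the leading coefficients of the elements of \<open>J\<close>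
  over all their representations with top term of degree \<open>d\<close>.\<close>

definition (in ring) leading_coeffs :: "'a set \<Rightarrow> 'a \<Rightarrow> 'a set \<Rightarrow> nat \<Rightarrow> 'a set" where
  "leading_coeffs A x J d = {a \<in> A. \<exists>p \<in> low_degree A x d. a \<otimes> x [^] d \<oplus> p \<in> J}"

context cring
begin

context
  fixes A x
  assumes A: "subring A R" and x: "x \<in> carrier R"
begin

lemmas subring_A = subringE[OF A]

lemma coefficient_carrier: "a \<in> A \<Longrightarrow> a \<in> carrier R" using subring_A(1) by blast

lemma low_degree_SucI:
  "a \<in> A \<Longrightarrow> p \<in> low_degree A x d \<Longrightarrow> a \<otimes> x [^] d \<oplus> p \<in> low_degree A x (Suc d)"
  by (auto simp: line_extension_mem_iff)

lemma low_degree_SucE: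
  assumes "p \<in> low_degree A x (Suc d)"
  obtains a q where "a \<in> A" "q \<in> low_degree A x d" "p = a \<otimes> x [^] d \<oplus> q"
  using assms by (auto simp: line_extension_mem_iff)

lemma low_degree_carrier: "p \<in> low_degree A x d \<Longrightarrow> p \<in> carrier R"
proof (induction d arbitrary: p)
  case (Suc d)
  then show ?case using coefficient_carrier x by (auto elim!: low_degree_SucE simp del: low_degree.simps)
qed auto

lemma low_degree_zero: "\<zero> \<in> low_degree A x d"
proof (induction d)
  case (Suc d)
  then show ?case using low_degree_SucI[OF subring_A(2) Suc] x by simp
qed auto

lemma low_degree_add:
  "p \<in> low_degree A x d \<Longrightarrow> q \<in> low_degree A x d \<Longrightarrow> p \<oplus> q \<in> low_degree A x d"
proof (induction d arbitrary: p q)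
  case (Suc d)
  obtain a p' where a: "a \<in> A" "p' \<in> low_degree A x d" "p = a \<otimes> x [^] d \<oplus> p'"
    using Suc.prems(1) by (elim low_degree_SucE)
  obtain b q' where b: "b \<in> A" "q' \<in> low_degree A x d" "q = b \<otimes> x [^] d \<oplus> q'"
    using Suc.prems(2) by (elim low_degree_SucE)
  have "p \<oplus> q = (a \<oplus> b) \<otimes> x [^] d \<oplus> (p' \<oplus> q')"
    unfolding a(3) b(3) using coefficient_carrier[OF a(1)] coefficient_carrier[OF b(1)] low_degree_carrier[OF a(2)]
      low_degree_carrier[OF b(2)] x nat_pow_closed[OF x, of d] by algebra
  then show ?case using low_degree_SucI[OF _ Suc.IH[OF a(2) b(2)]] subring_A(7)[OF a(1) b(1)] by metis
qed auto

lemma low_degree_smult: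
  "c \<in> A \<Longrightarrow> p \<in> low_degree A x d \<Longrightarrow> c \<otimes> p \<in> low_degree A x d"
proof (induction d arbitrary: p)
  case 0 then show ?case using coefficient_carrier by auto
next
  case (Suc d)
  obtain a p' where a: "a \<in> A" "p' \<in> low_degree A x d" "p = a \<otimes> x [^] d \<oplus> p'"
    using Suc.prems(2) by (elim low_degree_SucE)
  have "c \<otimes> p = (c \<otimes> a) \<otimes> x [^] d \<oplus> c \<otimes> p'"
    unfolding a(3) using coefficient_carrier[OF a(1)] coefficient_carrier[OF Suc.prems(1)] low_degree_carrier[OF a(2)]
      nat_pow_closed[OF x, of d] by algebra
  then show ?case
    using low_degree_SucI[OF subring_A(6)[OF Suc.prems(1) a(1)] Suc.IH[OF Suc.prems(1) a(2)]] by simp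
qed

lemma low_degree_mono: "d \<le> e \<Longrightarrow> low_degree A x d \<subseteq> low_degree A x e"
proof (induction rule: dec_induct)
  case (step n)
  have "low_degree A x n \<subseteq> low_degree A x (Suc n)"
    using low_degree_SucI[OF subring_A(2)] x low_degree_carrier by fastforce
  then show ?case using step by blast
qed auto

lemma low_degree_shift: "p \<in> low_degree A x d \<Longrightarrow> x \<otimes> p \<in> low_degree A x (Suc d)"
proof (induction d arbitrary: p)
  case 0 then show ?case using low_degree_zero[of "Suc 0"] x by (simp del: low_degree.simps(2))
next
  case (Suc d)
  obtain a p' where a: "a \<in> A" "p' \<in> low_degree A x d" "p = a \<otimes> x [^] d \<oplus> p'"
    using Suc.prems by (elim low_degree_SucE)
  have "x \<otimes> p = a \<otimes> (x [^] d \<otimes> x) \<oplus> x \<otimes> p'"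
    unfolding a(3) using coefficient_carrier[OF a(1)] low_degree_carrier[OF a(2)]
      x nat_pow_closed[OF x, of d] by algebra
  then show ?case using low_degree_SucI[OF a(1) Suc.IH[OF a(2)]] by simp
qed

lemma low_degree_shift_pow: "p \<in> low_degree A x d \<Longrightarrow> x [^] (n::nat) \<otimes> p \<in> low_degree A x (n + d)"
proof (induction n)
  case 0 then show ?case using low_degree_carrier by simp
next
  case (Suc n)
  have "x [^] Suc n \<otimes> p = x \<otimes> (x [^] n \<otimes> p)"
    using x low_degree_carrier[OF Suc.prems] nat_pow_closed[OF x, of n] by (simp add: m_ac)
  then show ?case using low_degree_shift[OF Suc.IH[OF Suc.prems]] by simp
qed

lemma low_degree_mult:
  "p \<in> low_degree A x d \<Longrightarrow> q \<in> low_degree A x e \<Longrightarrow> p \<otimes> q \<in> low_degree A x (d + e)"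
proof (induction d arbitrary: p)
  case 0 then show ?case using low_degree_zero low_degree_carrier by auto
next
  case (Suc d)
  obtain a p' where a: "a \<in> A" "p' \<in> low_degree A x d" "p = a \<otimes> x [^] d \<oplus> p'"
    using Suc.prems by (elim low_degree_SucE)
  have "p \<otimes> q = a \<otimes> (x [^] d \<otimes> q) \<oplus> p' \<otimes> q"
    unfolding a(3) using coefficient_carrier[OF a(1)] low_degree_carrier[OF a(2)] low_degree_carrier[OF Suc.prems(2)]
      x nat_pow_closed[OF x, of d] by algebra
  moreover have "a \<otimes> (x [^] d \<otimes> q) \<oplus> p' \<otimes> q \<in> low_degree A x (d + e)"
    by (intro low_degree_add low_degree_smult a low_degree_shift_pow Suc)
  ultimately show ?case using low_degree_mono[of "d + e" "Suc d + e"] by auto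
qed

lemma carrier_eq_Union_low_degree:
  assumes gen: "carrier R = generate_ring R (insert x A)"
  shows "carrier R = (\<Union>d. low_degree A x d)"
proof
  have "y \<in> (\<Union>d. low_degree A x d)" if "y \<in> generate_ring R (insert x A)" for y
    using that
  proof induction
    case one
    have "\<one> \<otimes> x [^] (0::nat) \<oplus> \<zero> \<in> low_degree A x (Suc 0)"
      by (intro low_degree_SucI low_degree_zero subring_A)
    then show ?case by (metis UN_I UNIV_I nat_pow_0 one_closed r_one r_zero)
  next
    case (incl h)
    have "x \<in> low_degree A x 2" "h \<in> low_degree A x 1" if "h \<in> A"
      using low_degree_SucI[OF that low_degree_zero, of 0]
        low_degree_SucI[OF subring_A(3) low_degree_zero, of 1] coefficient_carrier[OF that] x
      by (simp_all add: numeral_2_eq_2 del: low_degree.simps)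
    moreover have "x \<in> low_degree A x 2"
      using low_degree_SucI[OF subring_A(3) low_degree_zero, of 1] x
      by (simp_all add: numeral_2_eq_2 del: low_degree.simps)
    ultimately show ?case using incl by blast
  next
    case (a_inv h)
    then obtain d where d: "h \<in> low_degree A x d" by blast
    have "\<ominus> h = (\<ominus> \<one>) \<otimes> h" using low_degree_carrier[OF d] by (simp add: l_minus)
    then show ?case using low_degree_smult[OF _ d, of "\<ominus> \<one>"] subring_A(3,5) by (metis UN_I UNIV_I)
  next
    case (eng_add h1 h2)
    then obtain d e where "h1 \<in> low_degree A x d" "h2 \<in> low_degree A x e" by blast
    then have "h1 \<in> low_degree A x (max d e)" "h2 \<in> low_degree A x (max d e)"
      using low_degree_mono[of d "max d e"] low_degree_mono[of e "max d e"] by auto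
    then show ?case using low_degree_add by blast
  next
    case (eng_mult h1 h2)
    then show ?case using low_degree_mult by blast
  qed
  then show "carrier R \<subseteq> (\<Union>d. low_degree A x d)" using gen by blast
qed (use low_degree_carrier in blast)

lemma leading_coeffs_ideal:
  assumes J: "ideal J R"
  shows "ideal (leading_coeffs A x J d) (R\<lparr>carrier := A\<rparr>)"
proof (rule ideal_of_subringI[OF A])
  note Jp = ideal_closed[OF J]
  show "leading_coeffs A x J d \<subseteq> A" by (auto simp: leading_coeffs_def)
  show "\<zero> \<in> leading_coeffs A x J d"
    using subring_A(2) low_degree_zero[of d] x Jp(2) by (force simp: leading_coeffs_def)
next
  fix a b assume "a \<in> leading_coeffs A x J d" "b \<in> leading_coeffs A x J d"
  then obtain p q where a: "a \<in> A" "p \<in> low_degree A x d" "a \<otimes> x [^] d \<oplus> p \<in> J"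
    and b: "b \<in> A" "q \<in> low_degree A x d" "b \<otimes> x [^] d \<oplus> q \<in> J"
    by (auto simp: leading_coeffs_def)
  have "(a \<oplus> b) \<otimes> x [^] d \<oplus> (p \<oplus> q) = (a \<otimes> x [^] d \<oplus> p) \<oplus> (b \<otimes> x [^] d \<oplus> q)"
    using coefficient_carrier[OF a(1)] coefficient_carrier[OF b(1)] low_degree_carrier[OF a(2)]
      low_degree_carrier[OF b(2)] nat_pow_closed[OF x, of d] by algebra
  then have "(a \<oplus> b) \<otimes> x [^] d \<oplus> (p \<oplus> q) \<in> J"
    using ideal_closed(3)[OF J a(3) b(3)] by simp
  then show "a \<oplus> b \<in> leading_coeffs A x J d"
    using subring_A(7)[OF a(1) b(1)] low_degree_add[OF a(2) b(2)] by (auto simp: leading_coeffs_def)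
next
  fix c a assume c: "c \<in> A" and "a \<in> leading_coeffs A x J d"
  then obtain p where a: "a \<in> A" "p \<in> low_degree A x d" "a \<otimes> x [^] d \<oplus> p \<in> J"
    by (auto simp: leading_coeffs_def)
  have "(c \<otimes> a) \<otimes> x [^] d \<oplus> c \<otimes> p = c \<otimes> (a \<otimes> x [^] d \<oplus> p)"
    using coefficient_carrier[OF a(1)] coefficient_carrier[OF c] low_degree_carrier[OF a(2)]
      nat_pow_closed[OF x, of d] by algebra
  then have "(c \<otimes> a) \<otimes> x [^] d \<oplus> c \<otimes> p \<in> J"
    using ideal_closed(6)[OF J coefficient_carrier[OF c] a(3)] by simp
  then show "c \<otimes> a \<in> leading_coeffs A x J d"
    using subring_A(6)[OF c a(1)] low_degree_smult[OF c a(2)] by (auto simp: leading_coeffs_def)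
qed

lemma leading_coeffs_mono_degree:
  assumes J: "ideal J R" and "d \<le> e"
  shows "leading_coeffs A x J d \<subseteq> leading_coeffs A x J e"
  using \<open>d \<le> e\<close>
proof (induction rule: dec_induct)
  case (step n)
  have "leading_coeffs A x J n \<subseteq> leading_coeffs A x J (Suc n)"
  proof
    fix a assume "a \<in> leading_coeffs A x J n"
    then obtain p where a: "a \<in> A" "p \<in> low_degree A x n" "a \<otimes> x [^] n \<oplus> p \<in> J"
      by (auto simp: leading_coeffs_def)
    have "a \<otimes> x [^] Suc n \<oplus> x \<otimes> p = x \<otimes> (a \<otimes> x [^] n \<oplus> p)"
      using coefficient_carrier[OF a(1)] low_degree_carrier[OF a(2)] x nat_pow_closed[OF x, of n]
      by (simp add: m_ac r_distr)
    then have "a \<otimes> x [^] Suc n \<oplus> x \<otimes> p \<in> J"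
      using ideal_closed(6)[OF J x a(3)] by simp
    then show "a \<in> leading_coeffs A x J (Suc n)"
      using a(1) low_degree_shift[OF a(2)] by (auto simp: leading_coeffs_def)
  qed
  then show ?case using step by blast
qed auto

text \<open>Subtracting from an element of \<open>J\<close> an element of \<open>N\<close> with the same leading term lowers the degree
  and stays in \<open>J\<close>.\<close>

lemma ideal_eq_if_leading_coeffs_eq:
  assumes gen: "carrier R = generate_ring R (insert x A)"
    and J: "ideal J R" and N: "ideal N R" and "N \<subseteq> J"
    and lead: "\<And>d. leading_coeffs A x J d \<subseteq> leading_coeffs A x N d"
  shows "N = J"
proof
  have "y \<in> N" if "y \<in> J" "y \<in> low_degree A x d" for y d
    using that
  proof (induction d arbitrary: y)
    case 0 then show ?case using ideal_closed(2)[OF N] by simp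
  next
    case (Suc d)
    obtain a p where a: "a \<in> A" "p \<in> low_degree A x d" "y = a \<otimes> x [^] d \<oplus> p"
      using Suc.prems(2) by (elim low_degree_SucE)
    then have "a \<in> leading_coeffs A x J d" using Suc.prems(1) by (auto simp: leading_coeffs_def)
    then obtain q where q: "q \<in> low_degree A x d" "a \<otimes> x [^] d \<oplus> q \<in> N"
      using lead by (force simp: leading_coeffs_def)
    have carr: "a \<in> carrier R" "p \<in> carrier R" "q \<in> carrier R" "x [^] d \<in> carrier R"
      using a(1,2) q(1) coefficient_carrier low_degree_carrier x by auto
    have eq: "p \<oplus> (\<ominus> \<one>) \<otimes> q = y \<ominus> (a \<otimes> x [^] d \<oplus> q)" unfolding a(3) using carr by algebra
    have "p \<oplus> (\<ominus> \<one>) \<otimes> q \<in> J" unfolding eq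
      using ideal_closed(5)[OF J] Suc.prems(1) q(2) \<open>N \<subseteq> J\<close> by blast
    moreover have "p \<oplus> (\<ominus> \<one>) \<otimes> q \<in> low_degree A x d"
      by (intro low_degree_add low_degree_smult a q subring_A)
    ultimately have "p \<oplus> (\<ominus> \<one>) \<otimes> q \<in> N" using Suc.IH by blast
    moreover have "y = (p \<oplus> (\<ominus> \<one>) \<otimes> q) \<oplus> (a \<otimes> x [^] d \<oplus> q)"
      unfolding a(3) using carr by algebra
    ultimately show ?case using q(2) ideal_closed(3)[OF N] by blast
  qed
  then show "J \<subseteq> N"
    using carrier_eq_Union_low_degree[OF gen] ideal_closed(1)[OF J] by blast
qed fact

text \<open>The leading coefficient ideals of \<open>J\<close> increase with the degree, hence are constant from some degree
  \<open>D\<close> on. Finitely many elements of \<open>J\<close> realize generators of the first \<open>D + 1\<close> of them, and the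
  ideal that these elements generate has the same leading coefficients as \<open>J\<close> in every degree.\<close>

theorem hilbert_basis:
  assumes noeth: "noetherian_ring (R\<lparr>carrier := A\<rparr>)"
    and gen: "carrier R = generate_ring R (insert x A)"
  shows "noetherian_ring R"
proof (rule noetherian_ringI)
  interpret A: noetherian_ring "R\<lparr>carrier := A\<rparr>" by fact
  fix J assume J: "ideal J R"
  let ?L = "leading_coeffs A x"
  have chain: "subset.chain {I. ideal I (R\<lparr>carrier := A\<rparr>)} (range (?L J))"
  proof (unfold subset_chain_def, intro conjI ballI)
    show "range (?L J) \<subseteq> {I. ideal I (R\<lparr>carrier := A\<rparr>)}" using leading_coeffs_ideal[OF J] by auto
  next
    fix X Y assume "X \<in> range (?L J)" "Y \<in> range (?L J)"
    then obtain d e where "X = ?L J d" "Y = ?L J e" by blast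
    then show "X \<subseteq> Y \<or> Y \<subseteq> X"
      using leading_coeffs_mono_degree[OF J, of d e] leading_coeffs_mono_degree[OF J, of e d]
        nat_le_linear[of d e] by blast
  qed
  have "\<Union>(range (?L J)) \<in> range (?L J)"
    by (rule A.ideal_chain_is_trivial[OF _ chain]) auto
  then obtain D where "\<Union>(range (?L J)) = ?L J D" by blast
  then have D: "?L J d \<subseteq> ?L J D" for d by blast
  have "\<exists>T. finite T \<and> T \<subseteq> J \<and> ?L J d \<subseteq> ?L (Idl T) d" for d
  proof -
    obtain B where B: "B \<subseteq> A" "finite B" "?L J d = Idl\<^bsub>R\<lparr>carrier := A\<rparr>\<^esub> B"
      using A.finetely_gen[OF leading_coeffs_ideal[OF J, of d]] by auto
    have "B \<subseteq> ?L J d" unfolding B(3) using A.genideal_self B(1) by auto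
    then have "\<forall>b\<in>B. \<exists>p. p \<in> low_degree A x d \<and> b \<otimes> x [^] d \<oplus> p \<in> J"
      by (auto simp: leading_coeffs_def)
    then obtain p where p: "\<And>b. b \<in> B \<Longrightarrow> p b \<in> low_degree A x d"
      "\<And>b. b \<in> B \<Longrightarrow> b \<otimes> x [^] d \<oplus> p b \<in> J" by metis
    define T where "T = (\<lambda>b. b \<otimes> x [^] d \<oplus> p b) ` B"
    have T: "finite T" "T \<subseteq> J" using B(2) p(2) by (auto simp: T_def)
    have TC: "T \<subseteq> carrier R" using T(2) ideal_closed(1)[OF J] by blast
    have "B \<subseteq> ?L (Idl T) d"
      using B(1) p(1) genideal_self[OF TC] unfolding leading_coeffs_def T_def by blast
    then have "?L J d \<subseteq> ?L (Idl T) d" unfolding B(3)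
      by (intro A.genideal_minimal leading_coeffs_ideal genideal_ideal TC)
    then show ?thesis using T by blast
  qed
  then obtain T where T: "\<And>d. finite (T d)" "\<And>d. T d \<subseteq> J" "\<And>d. ?L J d \<subseteq> ?L (Idl (T d)) d"
    by metis
  define U where "U = (\<Union>d\<le>D. T d)"
  have UJ: "U \<subseteq> J" using T(2) by (auto simp: U_def)
  then have UC: "U \<subseteq> carrier R" using ideal_closed(1)[OF J] by blast
  have *: "?L J d \<subseteq> ?L (Idl U) d" if "d \<le> D" for d
  proof -
    have "T d \<subseteq> U" using that by (auto simp: U_def)
    then have "Idl (T d) \<subseteq> Idl U" by (rule subset_Idl_subset[OF UC])
    then have "?L (Idl (T d)) d \<subseteq> ?L (Idl U) d" by (auto simp: leading_coeffs_def)
    then show ?thesis using T(3) by blast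
  qed
  have "?L J d \<subseteq> ?L (Idl U) d" for d
  proof (cases "d \<le> D")
    case False
    then have "?L (Idl U) D \<subseteq> ?L (Idl U) d"
      by (intro leading_coeffs_mono_degree genideal_ideal UC) auto
    then show ?thesis using D[of d] *[of D] by blast
  qed (rule *)
  then have "Idl U = J"
    using ideal_eq_if_leading_coeffs_eq[OF gen J genideal_ideal[OF UC] genideal_minimal[OF J UJ]] by simp
  moreover have "finite U" using T(1) by (auto simp: U_def)
  ultimately show "\<exists>U\<subseteq>carrier R. finite U \<and> J = Idl U" using UC by blast
qed

end

end

lemma (in field) noetherian: "noetherian_ring R"
proof (rule noetherian_ringI)
  fix I assume "ideal I R"
  then have "I = {\<zero>} \<or> I = carrier R" using all_ideals by blast
  then show "\<exists>B\<subseteq>carrier R. finite B \<and> I = Idl B"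
    using genideal_zero genideal_one by (metis empty_subsetI finite.emptyI finite.insertI
        insert_subset one_closed zero_closed)
qed

text \<open>The generators are adjoined one at a time; each step is the basis theorem inside the ring reached.\<close>

theorem (in cring) finitely_generated_noetherian:
  assumes K: "subring K R" and noeth: "noetherian_ring (R\<lparr>carrier := K\<rparr>)"
    and S: "finite S" "S \<subseteq> carrier R"
  shows "noetherian_ring (R\<lparr>carrier := generate_ring R (K \<union> S)\<rparr>)"
  using S
proof (induction S)
  case empty
  have "generate_ring R K = K"
    using generate_ringI[OF subringE(1)[OF K] K, of] by auto
  then show ?case using noeth by simp
next
  case (insert x S)
  define B where "B = generate_ring R (K \<union> insert x S)"
  define A where "A = generate_ring R (K \<union> S)"
  have KS: "K \<union> insert x S \<subseteq> carrier R" "K \<union> S \<subseteq> carrier R" using insert.prems subringE(1)[OF K] by auto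
  have B: "subring B R" and A: "subring A R"
    unfolding A_def B_def by (intro generate_ring_is_subring KS)+
  have AB: "A \<subseteq> B" unfolding A_def B_def using KS by (intro mono_generate_ring) auto
  have xB: "x \<in> B" unfolding B_def by (rule generate_ring.incl) auto
  interpret B: cring "R\<lparr>carrier := B\<rparr>"
    using subcring_iff[OF subringE(1)[OF B]] subcringI'[OF B] by blast
  have "subring A (R\<lparr>carrier := B\<rparr>)"
    using B.ring_incl_imp_subring[of A] AB subring_is_ring[OF A] by simp
  moreover have "noetherian_ring (R\<lparr>carrier := B\<rparr>\<lparr>carrier := A\<rparr>)"
    using insert by (simp add: A_def)
  moreover have "B = generate_ring R (insert x A)"
  proof
    have "K \<union> insert x S \<subseteq> insert x A" unfolding A_def by (auto intro: generate_ring.incl)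
    then show "B \<subseteq> generate_ring R (insert x A)"
      unfolding B_def using insert.prems subringE(1)[OF A] by (intro mono_generate_ring) auto
    show "generate_ring R (insert x A) \<subseteq> B"
      using insert.prems subringE(1)[OF A] AB xB by (intro generate_ring_min_subring1 B) auto
  qed
  then have "carrier (R\<lparr>carrier := B\<rparr>) = generate_ring (R\<lparr>carrier := B\<rparr>) (insert x A)"
    using subring_gen_equality[OF B, of "insert x A"] AB xB by simp
  ultimately show ?case unfolding B_def[symmetric] using B.hilbert_basis[of A x] xB by simp
qed

section \<open>Graded ideals of standard graded algebras\<close>

context standard_graded_algebra
begin

definition component :: "'a \<Rightarrow> nat \<Rightarrow> 'a" where
  "component x = (THE f. homogeneous_decomp R G x f)"

definition homogeneous :: "'a set" where
  "homogeneous = (\<Union>i. G i)"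

lemma piece_closed:
  shows "x \<in> G i \<Longrightarrow> x \<in> carrier R" "\<zero> \<in> G i"
    and "x \<in> G i \<Longrightarrow> y \<in> G i \<Longrightarrow> x \<oplus> y \<in> G i"
proof -
  interpret additive_subgroup "G i" R by (rule piece_subgroup)
  show "x \<in> G i \<Longrightarrow> x \<in> carrier R" "\<zero> \<in> G i"
    "x \<in> G i \<Longrightarrow> y \<in> G i \<Longrightarrow> x \<oplus> y \<in> G i"
    using a_subset by auto
qed

lemma homogeneous_carrier: "x \<in> homogeneous \<Longrightarrow> x \<in> carrier R"
  using piece_closed(1) by (auto simp: homogeneous_def)

lemma component_decomp: "x \<in> carrier R \<Longrightarrow> homogeneous_decomp R G x (component x)"
  unfolding component_def using theI'[OF direct_sum] .

lemma component_eqI: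
  assumes "homogeneous_decomp R G x f" shows "component x = f"
proof -
  have "x \<in> carrier R"
    using assms piece_closed(1) unfolding homogeneous_decomp_def by (auto intro!: finsum_closed)
  then show ?thesis using assms direct_sum component_decomp by blast
qed

lemma homogeneous_decompI:
  assumes f: "\<And>i. f i \<in> G i" and A: "finite A" "\<And>i. i \<notin> A \<Longrightarrow> f i = \<zero>"
    and x: "x = (\<Oplus>i\<in>A. f i)"
  shows "homogeneous_decomp R G x f"
proof -
  have sub: "{i. f i \<noteq> \<zero>} \<subseteq> A" using A(2) by blast
  have "(\<Oplus>i\<in>A. f i) = (\<Oplus>i\<in>{i. f i \<noteq> \<zero>}. f i)"
    using A(1) sub piece_closed(1)[OF f] by (intro add.finprod_mono_neutral_cong_right) auto
  then show ?thesis using f x finite_subset[OF sub A(1)] by (simp add: homogeneous_decomp_def)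
qed

lemma component_piece: "x \<in> carrier R \<Longrightarrow> component x i \<in> G i"
  using component_decomp by (auto simp: homogeneous_decomp_def)

lemma component_carrier: "x \<in> carrier R \<Longrightarrow> component x i \<in> carrier R"
  using component_piece piece_closed(1) by blast

lemma component_homogeneous: "x \<in> carrier R \<Longrightarrow> component x i \<in> homogeneous"
  using component_piece by (auto simp: homogeneous_def)

lemma finite_component: "x \<in> carrier R \<Longrightarrow> finite {i. component x i \<noteq> \<zero>}"
  using component_decomp by (auto simp: homogeneous_decomp_def)

lemma finsum_component:
  "x \<in> carrier R \<Longrightarrow> x = (\<Oplus>i\<in>{i. component x i \<noteq> \<zero>}. component x i)"
  using component_decomp by (auto simp: homogeneous_decomp_def)

lemma finsum_component_superset:
  assumes x: "x \<in> carrier R" and A: "finite A" "{i. component x i \<noteq> \<zero>} \<subseteq> A"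
  shows "x = (\<Oplus>i\<in>A. component x i)"
proof -
  have "(\<Oplus>i\<in>A. component x i) = (\<Oplus>i\<in>{i. component x i \<noteq> \<zero>}. component x i)"
    using A component_carrier[OF x] by (intro add.finprod_mono_neutral_cong_right) auto
  then show ?thesis using finsum_component[OF x] by simp
qed

text \<open>Statements that survive addition need to be checked on homogeneous elements only. This replaces
  computations with sums of components throughout.\<close>

lemma sum_of_components_induct:
  assumes x: "x \<in> carrier R"
    and zero: "P \<zero>"
    and add: "\<And>a b. a \<in> carrier R \<Longrightarrow> b \<in> carrier R \<Longrightarrow> P a \<Longrightarrow> P b \<Longrightarrow> P (a \<oplus> b)"
    and comp: "\<And>i. P (component x i)"
  shows "P x"
proof -
  have "P (\<Oplus>i\<in>A. component x i)" if "finite A" for A :: "nat set"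
    using that
  proof (induction A)
    case (insert i A)
    then show ?case using add comp component_carrier[OF x] by simp
  qed (simp add: zero)
  then show ?thesis using finsum_component[OF x] finite_component[OF x] by metis
qed

lemma homogeneous_induct [consumes 1, case_names zero add homog]:
  assumes x: "x \<in> carrier R"
    and "P \<zero>"
    and "\<And>a b. a \<in> carrier R \<Longrightarrow> b \<in> carrier R \<Longrightarrow> P a \<Longrightarrow> P b \<Longrightarrow> P (a \<oplus> b)"
    and homog: "\<And>a i. a \<in> G i \<Longrightarrow> P a"
  shows "P x"
  using assms(1,2,3) homog[OF component_piece[OF x]] by (rule sum_of_components_induct)

lemma component_in_piece:
  assumes "x \<in> G i" shows "component x j = (if j = i then x else \<zero>)"
proof -
  have "homogeneous_decomp R G x (\<lambda>j. if j = i then x else \<zero>)"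
    using assms piece_closed by (intro homogeneous_decompI[of _ "{i}"]) auto
  then show ?thesis by (simp add: component_eqI)
qed

lemma component_zero: "component \<zero> j = \<zero>"
  using component_in_piece[OF piece_closed(2)] by simp

lemma component_add:
  assumes "x \<in> carrier R" "y \<in> carrier R"
  shows "component (x \<oplus> y) j = component x j \<oplus> component y j"
proof -
  let ?A = "{i. component x i \<noteq> \<zero>} \<union> {i. component y i \<noteq> \<zero>}"
  have fin: "finite ?A" using assms finite_component by auto
  have "x = (\<Oplus>i\<in>?A. component x i)" "y = (\<Oplus>i\<in>?A. component y i)"
    by (rule finsum_component_superset; use assms fin in auto)+
  moreover have "(\<Oplus>i\<in>?A. component x i \<oplus> component y i) =
      (\<Oplus>i\<in>?A. component x i) \<oplus> (\<Oplus>i\<in>?A. component y i)"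
    using component_carrier assms by (intro finsum_addf) auto
  ultimately have "x \<oplus> y = (\<Oplus>i\<in>?A. component x i \<oplus> component y i)" by simp
  then have "homogeneous_decomp R G (x \<oplus> y) (\<lambda>i. component x i \<oplus> component y i)"
    using fin assms component_piece piece_closed by (intro homogeneous_decompI[of _ ?A]) auto
  then show ?thesis by (simp add: component_eqI)
qed

lemma component_mult:
  assumes a: "a \<in> G d" and x: "x \<in> carrier R"
  shows "component (a \<otimes> x) n = (if d \<le> n then a \<otimes> component x (n - d) else \<zero>)"
  using x
proof (induction x rule: homogeneous_induct)
  case zero
  then show ?case using piece_closed(1)[OF a] by (simp add: component_zero)
next
  case (add b c)
  then show ?case
    using piece_closed(1)[OF a] by (simp add: component_add r_distr component_carrier)
next
  case (homog b e)
  have "component (a \<otimes> b) n = (if n = d + e then a \<otimes> b else \<zero>)"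
    by (rule component_in_piece[OF mult_graded[OF a homog]])
  then show ?case
    using component_in_piece[OF homog] piece_closed(1)[OF a] by auto
qed

definition closed_under_components :: "'a set \<Rightarrow> bool" where
  "closed_under_components J \<longleftrightarrow> (\<forall>x\<in>J. \<forall>i. component x i \<in> J)"

lemma graded_ideal_iff: "graded_ideal R G J \<longleftrightarrow> ideal J R \<and> closed_under_components J"
proof (cases "ideal J R")
  case True
  have "homogeneous_decomp R G x f \<longleftrightarrow> f = component x" if "x \<in> J" for x f
    using that ideal_closed(1)[OF True] component_decomp component_eqI by blast
  then show ?thesis using True by (auto simp: graded_ideal_def closed_under_components_def)
qed (simp add: graded_ideal_def)

lemma graded_ideal_induct [consumes 2, case_names zero add homog]:
  assumes J: "graded_ideal R G J" and x: "x \<in> J"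
    and "P \<zero>"
    and "\<And>a b. a \<in> carrier R \<Longrightarrow> b \<in> carrier R \<Longrightarrow> P a \<Longrightarrow> P b \<Longrightarrow> P (a \<oplus> b)"
    and homog: "\<And>a i. a \<in> G i \<Longrightarrow> a \<in> J \<Longrightarrow> P a"
  shows "P x"
proof -
  have xc: "x \<in> carrier R" using J x ideal_closed(1) by (auto simp: graded_ideal_def)
  have "P (component x i)" for i
    using J x homog[OF component_piece[OF xc]]
    by (auto simp: graded_ideal_iff closed_under_components_def)
  with xc assms(3,4) show ?thesis by (rule sum_of_components_induct)
qed

text \<open>Multiplying by a homogeneous element only shifts degrees, and every multiplier is a sum of
  homogeneous ones.\<close>

lemma elements_with_components_in_ideal:
  assumes N: "ideal N R"
  shows "ideal {x \<in> carrier R. \<forall>i. component x i \<in> N} R"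
proof (rule idealI_closed)
  fix a b assume a: "a \<in> carrier R" and "b \<in> {x \<in> carrier R. \<forall>i. component x i \<in> N}"
  then have b: "b \<in> carrier R" "\<And>i. component b i \<in> N" by auto
  from a have "\<forall>i. component (a \<otimes> b) i \<in> N"
  proof (induction a rule: homogeneous_induct)
    case (homog c d)
    then show ?case
      using b component_mult ideal_closed(2,6)[OF N] piece_closed(1)[OF homog] by simp
  qed (use b ideal_closed(2,3)[OF N] in \<open>auto simp: component_zero component_add l_distr\<close>)
  then show "a \<otimes> b \<in> {x \<in> carrier R. \<forall>i. component x i \<in> N}" using a b by simp
qed (use ideal_closed(2,3)[OF N] in \<open>auto simp: component_zero component_add\<close>)

lemma graded_ideal_genideal:
  assumes S: "S \<subseteq> homogeneous"
  shows "graded_ideal R G (Idl S)"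
proof -
  have SC: "S \<subseteq> carrier R" using S homogeneous_carrier by blast
  have "Idl S \<subseteq> {x \<in> carrier R. \<forall>i. component x i \<in> Idl S}"
  proof (rule genideal_minimal)
    show "ideal {x \<in> carrier R. \<forall>i. component x i \<in> Idl S} R"
      by (intro elements_with_components_in_ideal genideal_ideal SC)
    have "component s i \<in> Idl S" if s: "s \<in> S" for s i
    proof -
      obtain d where "s \<in> G d" using s S by (auto simp: homogeneous_def)
      then show ?thesis
        using s genideal_self[OF SC] ideal_closed(2)[OF genideal_ideal[OF SC]]
        by (auto simp: component_in_piece)
    qed
    then show "S \<subseteq> {x \<in> carrier R. \<forall>i. component x i \<in> Idl S}" using SC by blast
  qed
  then show ?thesis
    using genideal_ideal[OF SC] by (auto simp: graded_ideal_iff closed_under_components_def)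
qed

lemma graded_ideal_prod:
  assumes J: "graded_ideal R G J" and L: "graded_ideal R G L"
  shows "graded_ideal R G (J \<cdot> L)"
proof -
  have id: "ideal J R" "ideal L R" using J L by (auto simp: graded_ideal_def)
  note JL = ideal_closed[OF ideal_prod_is_ideal[OF id]]
  have "\<forall>i. component z i \<in> J \<cdot> L" if "z \<in> J \<cdot> L" for z
    using that
  proof induction
    case (prod j l)
    have lc: "l \<in> carrier R" "\<And>i. component l i \<in> L"
      using L prod(2) ideal_closed(1)[OF id(2)]
      by (auto simp: graded_ideal_iff closed_under_components_def)
    from J prod(1) show ?case
    proof (induction j rule: graded_ideal_induct)
      case (homog a d)
      then show ?case using lc JL(2) component_mult by (simp add: ideal_prod.prod)
    qed (use lc JL(2,3) in \<open>auto simp: component_zero component_add l_distr\<close>)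
  next
    case (sum s1 s2)
    have "s1 \<in> carrier R" "s2 \<in> carrier R" using sum(1,2) JL(1) by auto
    then show ?case using sum JL(3) by (auto simp: component_add)
  qed
  then show ?thesis
    using ideal_prod_is_ideal[OF id] by (auto simp: graded_ideal_iff closed_under_components_def)
qed

text \<open>The components of finitely many generators are finitely many homogeneous generators.\<close>

lemma graded_ideal_homogeneous_generators:
  assumes J: "graded_ideal R G J" and T: "finite T" "T \<subseteq> carrier R" "J = Idl T"
  shows "\<exists>S \<subseteq> homogeneous \<inter> J. finite S \<and> Idl S = J"
proof -
  define S where "S = (\<Union>t\<in>T. component t ` {i. component t i \<noteq> \<zero>})"
  have TJ: "T \<subseteq> J" using T genideal_self by auto
  have S: "S \<subseteq> homogeneous \<inter> J"
    using T(2) J TJ component_homogeneous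
    by (auto simp: S_def graded_ideal_iff closed_under_components_def)
  then have SC: "S \<subseteq> carrier R" using homogeneous_carrier by blast
  note I = ideal_closed[OF genideal_ideal[OF SC]]
  have "t \<in> Idl S" if t: "t \<in> T" for t
  proof -
    have "component t i \<in> Idl S" for i
      using t genideal_self[OF SC] I(2) by (cases "component t i = \<zero>") (auto simp: S_def)
    moreover have "t \<in> carrier R" using t T(2) by blast
    ultimately show ?thesis
      using sum_of_components_induct[of t "\<lambda>y. y \<in> Idl S"] I(2,3) by blast
  qed
  then have "J \<subseteq> Idl S" unfolding T(3) by (intro genideal_minimal genideal_ideal SC) auto
  moreover have "Idl S \<subseteq> J" using S J by (intro genideal_minimal) (auto simp: graded_ideal_def)
  moreover have "finite S" unfolding S_def using T(1,2) finite_component by auto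
  ultimately show ?thesis using S by blast
qed

lemma noetherian: "noetherian_ring R"
proof -
  obtain S where S: "finite S" "S \<subseteq> G 1" "carrier R = generate_ring R (G 0 \<union> S)"
    using generated_in_degree_one by blast
  have "noetherian_ring (R\<lparr>carrier := G 0\<rparr>)"
    by (intro field.noetherian subfield_iff(2) ground_field)
  then have "noetherian_ring (R\<lparr>carrier := generate_ring R (G 0 \<union> S)\<rparr>)"
    using S piece_closed(1)
    by (intro finitely_generated_noetherian subfieldE(1)[OF ground_field]) auto
  then show ?thesis unfolding S(3)[symmetric] by simp
qed

text \<open>An element lies in the ideal of positive degrees exactly if its constant term vanishes, because
  taking the constant term is multiplicative.\<close>

lemma graded_maximal_ideal_eq:
  "graded_maximal_ideal R G = {x \<in> carrier R. component x 0 = \<zero>}" (is "?m = ?Z")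
proof
  let ?P = "\<Union>i\<in>{1..}. G i"
  have PC: "?P \<subseteq> carrier R" using piece_closed(1) by auto
  note m = ideal_closed[OF genideal_ideal[OF PC]]
  have "ideal ?Z R"
  proof (rule idealI_closed)
    fix a b assume a: "a \<in> carrier R" and b: "b \<in> ?Z"
    from a have "component (a \<otimes> b) 0 = \<zero>"
    proof (induction a rule: homogeneous_induct)
      case (homog c d)
      then show ?case using b component_mult piece_closed(1)[OF homog] by simp
    qed (use b in \<open>auto simp: component_zero component_add l_distr\<close>)
    then show "a \<otimes> b \<in> ?Z" using a b by simp
  qed (auto simp: component_zero component_add)
  then show "?m \<subseteq> ?Z"
    unfolding graded_maximal_ideal_def
    using piece_closed(1) component_in_piece by (intro genideal_minimal) force+
  show "?Z \<subseteq> ?m"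
  proof
    fix x assume x: "x \<in> ?Z"
    have "component x i \<in> Idl ?P" for i
    proof (cases "i = 0")
      case True then show ?thesis using x m(2) by simp
    next
      case False
      then have "component x i \<in> ?P" using component_piece[of x i] x by force
      then show ?thesis using genideal_self[OF PC] by blast
    qed
    then show "x \<in> ?m"
      unfolding graded_maximal_ideal_def
      using x sum_of_components_induct[of x "\<lambda>y. y \<in> Idl ?P"] m(2,3) by blast
  qed
qed

lemma graded_maximal_ideal_graded: "graded_ideal R G (graded_maximal_ideal R G)"
  unfolding graded_maximal_ideal_def by (rule graded_ideal_genideal) (auto simp: homogeneous_def)

text \<open>An ideal that properly contains the positive degrees contains an element with nonzero constant
  term, hence that constant term itself, which is a unit of the ground field.\<close>

lemma maximalideal_graded_maximal_ideal: "maximalideal (graded_maximal_ideal R G) R"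
proof (rule maximalidealI)
  show m: "ideal (graded_maximal_ideal R G) R"
    using graded_maximal_ideal_graded by (simp add: graded_ideal_def)
  have one: "component \<one> 0 = \<one>" "\<one> \<noteq> \<zero>"
    using component_in_piece[OF subringE(3)[OF subfieldE(1)[OF ground_field]]]
      subfieldE(6)[OF ground_field] by auto
  then have "\<one> \<notin> graded_maximal_ideal R G" by (simp add: graded_maximal_ideal_eq)
  then show "carrier R \<noteq> graded_maximal_ideal R G" by blast
  fix J assume J: "ideal J R" "graded_maximal_ideal R G \<subseteq> J" "J \<subseteq> carrier R"
  show "J = graded_maximal_ideal R G \<or> J = carrier R"
  proof (rule ccontr)
    assume neg: "\<not> (J = graded_maximal_ideal R G \<or> J = carrier R)"
    then obtain x where x: "x \<in> J" "x \<notin> graded_maximal_ideal R G" using J by blast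
    define c where "c = component x 0"
    have xc: "x \<in> carrier R" using x J by blast
    have c: "c \<in> G 0 - {\<zero>}" "c \<in> carrier R"
      using x xc component_piece component_carrier by (auto simp: c_def graded_maximal_ideal_eq)
    have "component (x \<oplus> (\<ominus> \<one>) \<otimes> c) 0 = c \<oplus> (\<ominus> \<one>) \<otimes> c"
      using c xc component_mult[of "\<ominus> \<one>" 0 c 0] component_in_piece[of c 0 0]
        subringE(3,5)[OF subfieldE(1)[OF ground_field]]
      by (simp add: component_add c_def)
    also have "\<dots> = \<zero>" using c by algebra
    finally have "x \<oplus> (\<ominus> \<one>) \<otimes> c \<in> J" using J(2) c xc by (auto simp: graded_maximal_ideal_eq)
    then have "x \<ominus> (x \<oplus> (\<ominus> \<one>) \<otimes> c) \<in> J" using ideal_closed(5)[OF J(1) x(1)] by blast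
    moreover have "x \<ominus> (x \<oplus> (\<ominus> \<one>) \<otimes> c) = c" using c xc by algebra
    ultimately have "c \<in> J" by simp
    then have "inv c \<otimes> c \<in> J"
      using subfield_m_inv(1)[OF ground_field c(1)] piece_closed(1) ideal_closed(6)[OF J(1)] by blast
    then have "\<one> \<in> J" using subfield_m_inv(3)[OF ground_field c(1)] by simp
    then show False using neg ideal.one_imp_carrier[OF J(1)] by blast
  qed
qed

text \<open>By strong induction on the degree \<open>d\<close>, every element of \<open>J\<close> of degree \<open>d\<close> lies in \<open>Idl S\<close>: the part of
  degree \<open>d\<close> of \<open>\<mm> J\<close> is spanned by products of an element of positive degree with an element of \<open>J\<close>
  of degree less than \<open>d\<close>. Homogeneity of \<open>S\<close> is essential, since it makes \<open>Idl S\<close> graded.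
  For \<open>S = {1 - x}\<close> in a polynomial ring \<open>R = K[x]\<close> the conclusion fails with \<open>J = R\<close>.\<close>

theorem graded_nakayama:
  assumes J: "graded_ideal R G J" and S: "S \<subseteq> homogeneous \<inter> J"
    and gen: "J \<subseteq> Idl S <+> graded_maximal_ideal R G \<cdot> J"
  shows "Idl S = J"
proof
  let ?m = "graded_maximal_ideal R G"
  let ?N = "Idl S"
  have Ji: "ideal J R" and mi: "ideal ?m R"
    using J graded_maximal_ideal_graded by (auto simp: graded_ideal_def)
  show "?N \<subseteq> J" using S by (intro genideal_minimal Ji) auto
  have Ng: "graded_ideal R G ?N" using S by (intro graded_ideal_genideal) auto
  then have N: "ideal ?N R" by (simp add: graded_ideal_def)
  have homog: "y \<in> ?N" if "y \<in> J" "y \<in> G d" for y d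
    using that
  proof (induction d arbitrary: y rule: less_induct)
    case (less d)
    obtain n z where n: "n \<in> ?N" and z: "z \<in> ?m \<cdot> J" and y: "y = n \<oplus> z"
      using gen less.prems(1) by (auto simp: set_add_def')
    have "component z d \<in> ?N" using z
    proof induction
      case (prod m j)
      have jc: "j \<in> carrier R" "\<And>i. component j i \<in> J"
        using J prod(2) ideal_closed(1)[OF Ji]
        by (auto simp: graded_ideal_iff closed_under_components_def)
      from graded_maximal_ideal_graded prod(1) show ?case
      proof (induction m rule: graded_ideal_induct)
        case (homog a e)
        \<comment> \<open>An element of the maximal ideal of degree \<open>0\<close> is its own constant term, so it vanishes.\<close>
        consider "e = 0" | "d < e" | "0 < e" "e \<le> d" by linarith
        then show ?case
        proof cases
          case 1
          then have "a = \<zero>"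
            using homog component_in_piece[of a 0 0] by (simp add: graded_maximal_ideal_eq)
          then show ?thesis using jc ideal_closed(2)[OF N] by (simp add: component_zero)
        next
          case 2
          then show ?thesis using component_mult[OF homog(1) jc(1)] ideal_closed(2)[OF N] by simp
        next
          case 3
          then have "component j (d - e) \<in> ?N"
            using less.IH[of "d - e"] jc component_piece by auto
          then show ?thesis
            using 3 component_mult[OF homog(1) jc(1)] ideal_closed(6)[OF N] piece_closed(1)[OF homog(1)]
            by simp
        qed
      qed (use jc ideal_closed(2,3)[OF N] in \<open>auto simp: component_zero component_add l_distr\<close>)
    next
      case (sum s1 s2)
      have "s1 \<in> carrier R" "s2 \<in> carrier R"
        using sum(1,2) ideal_prod_in_carrier[OF mi Ji] by auto
      then show ?case using sum ideal_closed(3)[OF N] by (simp add: component_add)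
    qed
    moreover have "component n d \<in> ?N"
      using n Ng by (auto simp: graded_ideal_iff closed_under_components_def)
    moreover have "y = component n d \<oplus> component z d"
      using component_in_piece[OF less.prems(2), of d] y
        component_add[of n z d] n z ideal_closed(1)[OF N] ideal_prod_in_carrier[OF mi Ji] by auto
    ultimately show ?case using ideal_closed(3)[OF N] by simp
  qed
  show "J \<subseteq> ?N"
  proof
    fix x assume "x \<in> J"
    with J show "x \<in> ?N"
      by (induction x rule: graded_ideal_induct) (use ideal_closed(2,3)[OF N] homog in auto)
  qed
qed

end

section \<open>Nakayama's lemma in a Noetherian local ring\<close>

lemma (in cring) genideal_insert:
  assumes "x \<in> carrier R" "S \<subseteq> carrier R"
  shows "Idl (insert x S) = {a \<otimes> x \<oplus> y | a y. a \<in> carrier R \<and> y \<in> Idl S}" (is "_ = ?E")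
proof -
  have x: "ideal (PIdl x) R" and S: "ideal (Idl S) R"
    using assms cgenideal_ideal genideal_ideal by auto
  have "Idl (insert x S) = PIdl x <+> Idl S"
  proof
    have "insert x S \<subseteq> Idl (PIdl x \<union> Idl S)"
      using genideal_self[of "PIdl x \<union> Idl S"] genideal_self[OF assms(2)] cgenideal_self[OF assms(1)]
        ideal_closed(1)[OF x] ideal_closed(1)[OF S] by blast
    then show "Idl (insert x S) \<subseteq> PIdl x <+> Idl S"
      unfolding union_genideal[OF x S] by (rule genideal_minimal[OF add_ideals[OF x S]])
    have "insert x S \<subseteq> carrier R" using assms by auto
    note I = genideal_ideal[OF this] genideal_self[OF this]
    have "PIdl x \<subseteq> Idl (insert x S)" "Idl S \<subseteq> Idl (insert x S)"
      using I by (auto intro!: cgenideal_minimal genideal_minimal del: subsetI)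
    then show "PIdl x <+> Idl S \<subseteq> Idl (insert x S)"
      using ideal_closed(3)[OF I(1)] by (auto simp: set_add_def')
  qed
  also have "\<dots> = ?E" by (auto simp: set_add_def' cgenideal_def)
  finally show ?thesis .
qed

lemma (in ring) ideal_sum_upper:
  assumes "ideal J R" "ideal L R"
  shows "J \<subseteq> J <+> L" "L \<subseteq> J <+> L"
  using assms union_genideal[OF assms] genideal_self[of "J \<union> L"] ideal_closed(1) by blast+

lemma (in ring) ideal_sum_least:
  assumes "ideal M R" "J \<subseteq> M" "L \<subseteq> M"
  shows "J <+>\<^bsub>R\<^esub> L \<subseteq> M"
  using assms ideal_closed(3)[OF assms(1)] by (auto simp: set_add_def')

lemma (in cring) ideal_prod_principal_mem:
  assumes "ideal J R" "x \<in> carrier R" "z \<in> J \<cdot> (PIdl x)"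
  shows "\<exists>m\<in>J. z = m \<otimes> x"
  using assms(3)
proof induction
  case (prod i j)
  then obtain a where "a \<in> carrier R" "j = a \<otimes> x" by (auto simp: cgenideal_def)
  moreover have "i \<in> carrier R" using prod ideal_closed(1)[OF assms(1)] by blast
  ultimately have "i \<otimes> j = (i \<otimes> a) \<otimes> x" using assms(2) by (simp add: m_assoc)
  then show ?case using ideal_closed(7)[OF assms(1) prod(1) \<open>a \<in> carrier R\<close>] by blast
next
  case (sum s1 s2)
  then obtain m1 m2 where "m1 \<in> J" "m2 \<in> J" "s1 = m1 \<otimes> x" "s2 = m2 \<otimes> x" by blast
  moreover from this have "s1 \<oplus> s2 = (m1 \<oplus> m2) \<otimes> x"
    using assms(2) ideal_closed(1)[OF assms(1)] l_distr by (metis subsetD)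
  ultimately show ?case using ideal_closed(3)[OF assms(1)] by blast
qed

context noetherian_local_ring
begin

text \<open>A proper principal ideal lies in a maximal ideal, obtained by Zorn's lemma from the stabilization
  of chains; that maximal ideal can only be \<open>\<mm>\<close>.\<close>

lemma unit_if_notin_maximal:
  assumes x: "x \<in> carrier R" "x \<notin> \<mm>"
  shows "x \<in> Units R"
proof (rule ccontr)
  assume nu: "x \<notin> Units R"
  have nu': "\<one> \<notin> PIdl x"
    using nu x(1) m_comm unfolding Units_def cgenideal_def by fastforce
  define C where "C = {J. ideal J R \<and> PIdl x \<subseteq> J \<and> \<one> \<notin> J}"
  have "\<exists>M\<in>C. \<forall>J\<in>C. M \<subseteq> J \<longrightarrow> J = M"
  proof (rule subset_Zorn)
    fix D assume D: "subset.chain C D"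
    show "\<exists>U\<in>C. \<forall>J\<in>D. J \<subseteq> U"
    proof (cases "D = {}")
      case True
      then show ?thesis using nu' cgenideal_ideal[OF x(1)] by (auto simp: C_def)
    next
      case False
      have "subset.chain {I. ideal I R} D" using D by (auto simp: subset_chain_def C_def)
      then have "\<Union>D \<in> D" using ideal_chain_is_trivial False by blast
      then show ?thesis using D by (auto simp: subset_chain_def)
    qed
  qed
  then obtain M where M: "M \<in> C" "\<And>J. J \<in> C \<Longrightarrow> M \<subseteq> J \<Longrightarrow> J = M" by blast
  have "maximalideal M R"
  proof (rule maximalidealI)
    show "ideal M R" "carrier R \<noteq> M" using M(1) by (auto simp: C_def)
    fix J assume J: "ideal J R" "M \<subseteq> J" "J \<subseteq> carrier R"
    show "J = M \<or> J = carrier R"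
    proof (cases "\<one> \<in> J")
      case True
      then show ?thesis using ideal.one_imp_carrier[OF J(1)] by simp
    next
      case False
      then have "J \<in> C" using J M(1) by (auto simp: C_def)
      then show ?thesis using M(2) J(2) by simp
    qed
  qed
  then have "M = \<mm>" by (rule unique_maximal)
  moreover have "x \<in> M" using M(1) cgenideal_self[OF x(1)] by (auto simp: C_def)
  ultimately show False using x(2) by simp
qed

lemma maximal_ideal: "ideal \<mm> R"
  using maximal by (rule maximalideal.axioms)

lemma one_minus_unit:
  assumes m: "m \<in> \<mm>"
  shows "\<one> \<ominus> m \<in> Units R"
proof (rule unit_if_notin_maximal)
  have mc: "m \<in> carrier R" using m ideal_closed(1)[OF maximal_ideal] by blast
  then show "\<one> \<ominus> m \<in> carrier R" by simp
  show "\<one> \<ominus> m \<notin> \<mm>"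
  proof
    assume "\<one> \<ominus> m \<in> \<mm>"
    then have "(\<one> \<ominus> m) \<oplus> m \<in> \<mm>" using m ideal_closed(3)[OF maximal_ideal] by blast
    moreover have "(\<one> \<ominus> m) \<oplus> m = \<one>" using mc by algebra
    ultimately have "\<one> \<in> \<mm>" by simp
    then show False
      using ideal.one_imp_carrier[OF maximal_ideal] maximalideal.I_notcarr[OF maximal] by simp
  qed
qed

text \<open>Induction on the number of generators. With \<open>T\<close> the other generators, the
  generator \<open>t\<close> satisfies \<open>t = m t + w\<close> with \<open>m \<in> \<mm>\<close> and \<open>w \<in> N + \<mm> T\<close>; since \<open>1 - m\<close> is a unit, \<open>t\<close> itself lies
  in \<open>N + \<mm> T\<close>, and it can be eliminated from the conditions on \<open>T\<close>.\<close>

lemma nakayama_finite: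
  assumes N: "ideal N R" and "finite T" "T \<subseteq> carrier R" "T \<subseteq> N <+> \<mm> \<cdot> (Idl T)"
  shows "T \<subseteq> N"
  using assms(2-)
proof (induction T)
  case (insert t T)
  have t: "t \<in> carrier R" and T: "T \<subseteq> carrier R" using insert.prems by auto
  have IT: "ideal (Idl T) R" by (rule genideal_ideal[OF T])
  let ?Z = "\<mm> \<cdot> (Idl T)"
  let ?W = "N <+>\<^bsub>R\<^esub> ?Z"
  have Z: "ideal ?Z R" by (rule ideal_prod_is_ideal[OF maximal_ideal IT])
  have W: "ideal ?W R" by (rule add_ideals[OF N Z])
  have NW: "N \<subseteq> ?W" "?Z \<subseteq> ?W" by (rule ideal_sum_upper[OF N Z])+
  have Pt: "ideal (PIdl t) R" by (rule cgenideal_ideal[OF t])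
  have "Idl (insert t T) = PIdl t <+> Idl T"
    unfolding genideal_insert[OF t T] by (auto simp: set_add_def' cgenideal_def)
  then have prod_eq: "\<mm> \<cdot> (Idl (insert t T)) = \<mm> \<cdot> (PIdl t) <+> ?Z"
    using ideal_prod_r_distr[OF maximal_ideal Pt IT] by simp
  have form: "\<exists>m\<in>\<mm>. \<exists>w\<in>?W. y = m \<otimes> t \<oplus> w" if y: "y \<in> insert t T" for y
  proof -
    have "y \<in> N <+> (\<mm> \<cdot> (PIdl t) <+> ?Z)" using y insert.prems(2) prod_eq by auto
    then obtain n p z where nz: "n \<in> N" "p \<in> \<mm> \<cdot> (PIdl t)" "z \<in> ?Z" "y = n \<oplus> (p \<oplus> z)"
      by (auto simp: set_add_def')
    obtain m where m: "m \<in> \<mm>" "p = m \<otimes> t"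
      using ideal_prod_principal_mem[OF maximal_ideal t nz(2)] by blast
    have "n \<in> carrier R" "z \<in> carrier R" "m \<in> carrier R"
      using nz m ideal_closed(1)[OF N] ideal_closed(1)[OF Z] ideal_closed(1)[OF maximal_ideal]
      by auto
    then have "y = m \<otimes> t \<oplus> (n \<oplus> z)" unfolding nz(4) m(2) using t by (simp add: a_ac)
    moreover have "n \<oplus> z \<in> ?W" using nz by (auto simp: set_add_def')
    ultimately show ?thesis using m(1) by blast
  qed
  obtain m w where m: "m \<in> \<mm>" and w: "w \<in> ?W" and tm: "t = m \<otimes> t \<oplus> w" using form by blast
  have mc: "m \<in> carrier R" and wc: "w \<in> carrier R"
    using m w ideal_closed(1)[OF maximal_ideal] ideal_closed(1)[OF W] by auto
  have u: "\<one> \<ominus> m \<in> Units R" by (rule one_minus_unit[OF m])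
  have "(\<one> \<ominus> m) \<otimes> t = t \<ominus> m \<otimes> t" using mc t by algebra
  also have "\<dots> = (m \<otimes> t \<oplus> w) \<ominus> m \<otimes> t" using tm by simp
  also have "\<dots> = w" using mc wc t by algebra
  finally have ut: "(\<one> \<ominus> m) \<otimes> t = w" .
  have "t = inv (\<one> \<ominus> m) \<otimes> ((\<one> \<ominus> m) \<otimes> t)"
    using u t by (simp add: m_assoc[symmetric] Units_closed)
  then have tW: "t \<in> ?W" using ut ideal_closed(6)[OF W _ w] Units_inv_closed[OF u] by simp
  have "T \<subseteq> ?W"
  proof
    fix y assume "y \<in> T"
    then obtain m w where "m \<in> \<mm>" "w \<in> ?W" "y = m \<otimes> t \<oplus> w" using form by blast
    then show "y \<in> ?W"
      using ideal_closed(3,6)[OF W] tW ideal_closed(1)[OF maximal_ideal] by blast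
  qed
  then have TN: "T \<subseteq> N" using insert.IH T by blast
  then have "Idl T \<subseteq> N" by (rule genideal_minimal[OF N])
  then have "?Z \<subseteq> N" using ideal_prod_inter[OF maximal_ideal IT] by blast
  then have "?W \<subseteq> N" by (intro ideal_sum_least N) auto
  then show ?case using tW TN by blast
qed auto

theorem local_nakayama:
  assumes J: "ideal J R" and S: "S \<subseteq> J" and gen: "J \<subseteq> Idl S <+> \<mm> \<cdot> J"
  shows "Idl S = J"
proof
  show le: "Idl S \<subseteq> J" by (rule genideal_minimal[OF J S])
  have SC: "S \<subseteq> carrier R" using S ideal_closed(1)[OF J] by blast
  obtain T where T: "T \<subseteq> carrier R" "finite T" "J = Idl T" using finetely_gen[OF J] by blast
  have "T \<subseteq> Idl S"
  proof (rule nakayama_finite[OF genideal_ideal[OF SC] T(2,1)])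
    show "T \<subseteq> Idl S <+> \<mm> \<cdot> (Idl T)" using gen genideal_self[OF T(1)] unfolding T(3) by blast
  qed
  then show "J \<subseteq> Idl S" unfolding T(3) by (rule genideal_minimal[OF genideal_ideal[OF SC]])
qed

end

section \<open>Minimal numbers of generators and bases\<close>

lemma min_gens_le:
  assumes "S \<subseteq> carrier R" "finite S" "genideal R S = L"
  shows "min_gens R L \<le> card S"
  unfolding min_gens_def using assms by (intro Least_le) blast

lemma min_gens_attained:
  assumes "S \<subseteq> carrier R" "finite S" "genideal R S = L"
  obtains T where "T \<subseteq> carrier R" "finite T" "card T = min_gens R L" "genideal R T = L"
proof -
  have "\<exists>n T. T \<subseteq> carrier R \<and> finite T \<and> card T = n \<and> genideal R T = L" using assms by blast
  from LeastI_ex[OF this] show ?thesis using that unfolding min_gens_def by blast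
qed

text \<open>Selecting a basis from a given spanning list, and not merely some basis of its span: the basis
  vectors must remain classes of admissible generators.\<close>

lemma (in ring) independent_sublist:
  assumes K: "subfield K R" and "set Us \<subseteq> carrier R"
  shows "\<exists>Vs. set Vs \<subseteq> set Us \<and> independent K Vs \<and> Span K Vs = Span K Us"
  using assms(2)
proof (induction Us)
  case Nil
  then show ?case by (intro exI[of _ "[]"]) auto
next
  case (Cons u Us)
  then obtain Vs where Vs: "set Vs \<subseteq> set Us" "independent K Vs" "Span K Vs = Span K Us" by auto
  show ?case
  proof (cases "u \<in> Span K Us")
    case True
    have "Span K (u # Us) \<subseteq> Span K Us" "Span K Us \<subseteq> Span K (u # Us)"
      using mono_Span_subset[OF K, of "u # Us" Us] mono_Span_subset[OF K, of Us "u # Us"]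
        Span_base_incl[OF K, of Us] Span_base_incl[OF K, of "u # Us"] Cons.prems True by auto
    then show ?thesis using Vs by (intro exI[of _ Vs]) auto
  next
    case False
    then have "independent K (u # Vs)" using Vs Cons.prems by (auto intro: li_Cons)
    moreover have "Span K (u # Vs) = Span K (u # Us)" using Vs(3) by simp
    ultimately show ?thesis using Vs(1) by (intro exI[of _ "u # Vs"]) auto
  qed
qed

section \<open>The fiber ring as a quotient of the Rees algebra\<close>

lemma (in cring) ideal_power_ideal: "ideal I R \<Longrightarrow> ideal (ideal_power R I k) R"
proof -
  assume I: "ideal I R"
  interpret M: comm_monoid "ideals_set R" by (rule ideals_set_is_comm_monoid)
  have "I [^]\<^bsub>ideals_set R\<^esub> k \<in> carrier (ideals_set R)"
    using I by (intro M.nat_pow_closed) (simp add: ideals_set_def)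
  then show ?thesis by (simp add: ideal_power_def ideals_set_def)
qed

lemma ideal_power_0: "ideal_power R I 0 = carrier R"
  by (simp add: ideal_power_def nat_pow_def ideals_set_def)

lemma ideal_power_Suc: "ideal_power R I (Suc k) = ideal_power R I k \<cdot>\<^bsub>R\<^esub> I"
  by (simp add: ideal_power_def nat_pow_def ideals_set_def)

lemma (in cring) ideal_power_1: "ideal I R \<Longrightarrow> ideal_power R I 1 = I"
  using ideal_power_Suc[of R I 0] ideal_power_0[of R I] ideal_prod_commute[OF oneideal, of I]
    ideal_prod_one by simp

lemma (in cring) ideal_power_add:
  assumes "ideal I R"
  shows "ideal_power R I (i + j) = ideal_power R I i \<cdot> ideal_power R I j"
proof -
  interpret M: comm_monoid "ideals_set R" by (rule ideals_set_is_comm_monoid)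
  have "I \<in> carrier (ideals_set R)" using assms by (simp add: ideals_set_def)
  from M.nat_pow_mult[OF this, of i j] show ?thesis by (simp add: ideal_power_def ideals_set_def)
qed

lemma (in abelian_monoid) finsum_mem:
  assumes "finite A" "H \<subseteq> carrier G" "\<zero> \<in> H" "\<And>a b. a \<in> H \<Longrightarrow> b \<in> H \<Longrightarrow> a \<oplus> b \<in> H"
    and "\<And>i. i \<in> A \<Longrightarrow> f i \<in> H"
  shows "finsum G f A \<in> H"
  using assms(1,5)
proof (induction A)
  case (insert i A)
  have "f \<in> A \<rightarrow> carrier G" "f i \<in> carrier G" using insert.prems assms(2) by auto
  then show ?case using insert assms(4) by (simp add: finsum_insert)
qed (simp add: assms(3))

lemma UP_simps:
  shows "carrier (UP R) = up R"
    and "\<one>\<^bsub>UP R\<^esub> = (\<lambda>i. if i = 0 then \<one>\<^bsub>R\<^esub> else \<zero>\<^bsub>R\<^esub>)"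
    and "\<zero>\<^bsub>UP R\<^esub> = (\<lambda>i. \<zero>\<^bsub>R\<^esub>)"
    and "p \<in> up R \<Longrightarrow> q \<in> up R \<Longrightarrow> p \<oplus>\<^bsub>UP R\<^esub> q = (\<lambda>i. p i \<oplus>\<^bsub>R\<^esub> q i)"
    and "p \<in> up R \<Longrightarrow> q \<in> up R \<Longrightarrow>
      p \<otimes>\<^bsub>UP R\<^esub> q = (\<lambda>n. \<Oplus>\<^bsub>R\<^esub>i\<in>{..n}. p i \<otimes>\<^bsub>R\<^esub> q (n - i))"
    and "x \<in> carrier R \<Longrightarrow> monom (UP R) x k = (\<lambda>i. if i = k then x else \<zero>\<^bsub>R\<^esub>)"
    and "p \<in> up R \<Longrightarrow> coeff (UP R) p k = p k"
  by (simp_all add: UP_def)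

text \<open>What the argument uses of the base ring, in a form that covers both kinds of base ring. The set \<open>H\<close> of
  admissible generators is the whole ring in the local case and the set of homogeneous elements in the
  graded case, where Nakayama's lemma is false for arbitrary elements.\<close>

locale nakayama_powers = cring R for R (structure) +
  fixes \<mm> I H
  assumes maximal_m: "maximalideal \<mm> R"
    and ideal_I: "ideal I R"
    and power_generators: "\<exists>S \<subseteq> H \<inter> ideal_power R I k. finite S \<and> Idl S = ideal_power R I k"
    and nakayama: "\<lbrakk> S \<subseteq> H \<inter> ideal_power R I k;
        ideal_power R I k \<subseteq> Idl S <+> \<mm> \<cdot> ideal_power R I k \<rbrakk> \<Longrightarrow> Idl S = ideal_power R I k"
begin

abbreviation I_pow :: "nat \<Rightarrow> 'a set" where "I_pow \<equiv> ideal_power R I"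
abbreviation mI_pow :: "nat \<Rightarrow> 'a set" where "mI_pow \<equiv> fiber_kernel R \<mm> I"
abbreviation F :: "(nat \<Rightarrow> 'a set) ring" where "F \<equiv> fiber_ring R \<mm> I"

lemma max_ideal: "ideal \<mm> R" using maximal_m by (rule maximalideal.axioms)
lemma I_pow_ideal: "ideal (I_pow k) R" by (rule ideal_power_ideal[OF ideal_I])
lemma mI_pow_ideal: "ideal (mI_pow k) R"
  unfolding fiber_kernel_def by (rule ideal_prod_is_ideal[OF max_ideal I_pow_ideal])

lemma I_pow_mult: "a \<in> I_pow i \<Longrightarrow> b \<in> I_pow j \<Longrightarrow> a \<otimes> b \<in> I_pow (i + j)"
  unfolding ideal_power_add[OF ideal_I] by (rule ideal_prod.prod)

lemma mI_pow_mult: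
  assumes "a \<in> mI_pow i" "b \<in> I_pow j" shows "a \<otimes> b \<in> mI_pow (i + j)"
proof -
  have "a \<otimes> b \<in> mI_pow i \<cdot> I_pow j" using assms by (rule ideal_prod.prod)
  then show ?thesis
    unfolding fiber_kernel_def ideal_power_add[OF ideal_I]
    using ideal_prod_assoc[OF max_ideal I_pow_ideal I_pow_ideal] by simp
qed

lemma I_pow_carrier: "x \<in> I_pow k \<Longrightarrow> x \<in> carrier R" using ideal_closed(1)[OF I_pow_ideal] by blast
lemma mI_pow_carrier: "x \<in> mI_pow k \<Longrightarrow> x \<in> carrier R" using ideal_closed(1)[OF mI_pow_ideal] by blast

lemma coset_eq_iff:
  "x \<in> carrier R \<Longrightarrow> y \<in> carrier R \<Longrightarrow> mI_pow k +> x = mI_pow k +> y \<longleftrightarrow> x \<ominus> y \<in> mI_pow k"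
  using quotient_eq_iff_same_a_r_cos[OF mI_pow_ideal] by blast

lemma coset_zero: "mI_pow k +> \<zero> = mI_pow k"
  using ideal_closed(1)[OF mI_pow_ideal] by simp

text \<open>The ideals \<open>\<mm> I\<^sup>i\<close> and \<open>\<mm> I\<^sup>j\<close> by which the two representatives may change differ from the modulus
  \<open>\<mm> I\<^bsup>i + j\<^esup>\<close>; the change of the product is nevertheless absorbed because the representatives lie in \<open>I\<^sup>i\<close>
  and \<open>I\<^sup>j\<close>.\<close>

lemma rcoset_mult_fiber:
  assumes x: "x \<in> I_pow i" and y: "y \<in> I_pow j"
  shows "rcoset_mult R (mI_pow (i + j)) (mI_pow i +> x) (mI_pow j +> y) = mI_pow (i + j) +> x \<otimes> y"
proof -
  have coset: "mI_pow (i + j) +> a \<otimes> b = mI_pow (i + j) +> x \<otimes> y"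
    if a: "a \<in> mI_pow i +> x" and b: "b \<in> mI_pow j +> y" for a b
  proof -
    obtain u where u: "u \<in> mI_pow i" "a = u \<oplus> x" using a by (auto simp: a_r_coset_def')
    obtain v where v: "v \<in> mI_pow j" "b = v \<oplus> y" using b by (auto simp: a_r_coset_def')
    note c = mI_pow_carrier[OF u(1)] mI_pow_carrier[OF v(1)] I_pow_carrier[OF x] I_pow_carrier[OF y]
    have kp: "v \<in> I_pow j"
      using v(1) ideal_prod_inter[OF max_ideal I_pow_ideal] unfolding fiber_kernel_def by blast
    have "a \<otimes> b \<ominus> x \<otimes> y = u \<otimes> (v \<oplus> y) \<oplus> v \<otimes> x" unfolding u(2) v(2) using c by algebra
    moreover have "u \<otimes> (v \<oplus> y) \<in> mI_pow (i + j)"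
      using mI_pow_mult[OF u(1)] ideal_closed(3)[OF I_pow_ideal kp y] by blast
    moreover have "v \<otimes> x \<in> mI_pow (i + j)" using mI_pow_mult[OF v(1) x] by (simp add: add.commute)
    ultimately have "a \<otimes> b \<ominus> x \<otimes> y \<in> mI_pow (i + j)" using ideal_closed(3)[OF mI_pow_ideal] by simp
    then show ?thesis using coset_eq_iff c u(2) v(2) by simp
  qed
  have "x \<in> mI_pow i +> x" "y \<in> mI_pow j +> y"
    using abelian_subgroup.a_rcos_self[OF abelian_subgroupI3[OF ideal.axioms(1) abelian_group_axioms]]
      mI_pow_ideal I_pow_carrier x y by auto
  then show ?thesis unfolding rcoset_mult_def using coset by blast
qed

text \<open>The Rees algebra \<open>\<Oplus> I\<^sup>k t\<^sup>k\<close> as a subring of \<open>R[t]\<close>.\<close>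

definition rees :: "(nat \<Rightarrow> 'a) set" where
  "rees = {p \<in> up R. \<forall>k. p k \<in> I_pow k}"

definition fiber_map :: "(nat \<Rightarrow> 'a) \<Rightarrow> nat \<Rightarrow> 'a set" where
  "fiber_map p = (\<lambda>k. mI_pow k +> p k)"

interpretation P: UP_cring R "UP R" by unfold_locales simp

lemma rees_subring: "subring rees (UP R)"
proof (rule P.P.subringI)
  show "rees \<subseteq> carrier (UP R)" by (auto simp: rees_def UP_simps)
  have "(\<lambda>i. if i = 0 then \<one> else \<zero>) k \<in> I_pow k" for k
    using ideal_closed(2)[OF I_pow_ideal] by (cases "k = 0") (simp_all add: ideal_power_0)
  then have "(\<lambda>i. if i = 0 then \<one> else \<zero>) \<in> rees"
    using up_one_closed unfolding rees_def by blast
  then show "\<one>\<^bsub>UP R\<^esub> \<in> rees" by (simp add: UP_simps)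
next
  fix p assume p: "p \<in> rees"
  then have pc: "p \<in> carrier (UP R)" by (auto simp: rees_def UP_simps)
  have "(\<ominus>\<^bsub>UP R\<^esub> p) \<in> up R" using P.P.a_inv_closed[OF pc] by (simp add: UP_simps)
  moreover from this have "(\<ominus>\<^bsub>UP R\<^esub> p) k = \<ominus> p k" for k
    using P.coeff_a_inv[OF pc, of k] pc by (simp add: UP_simps)
  ultimately show "\<ominus>\<^bsub>UP R\<^esub> p \<in> rees"
    using p ideal_closed(4)[OF I_pow_ideal] by (simp add: rees_def)
next
  fix p q assume pq: "p \<in> rees" "q \<in> rees"
  have "p i \<otimes> q (n - i) \<in> I_pow n" if "i \<le> n" for i n
    using I_pow_mult[of "p i" i "q (n - i)" "n - i"] pq that by (simp add: rees_def)
  then have "(\<Oplus>i\<in>{..n}. p i \<otimes> q (n - i)) \<in> I_pow n" for n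
    using ideal_closed(1-3)[OF I_pow_ideal] by (intro finsum_mem) auto
  then show "p \<otimes>\<^bsub>UP R\<^esub> q \<in> rees"
    using pq up_mult_closed by (simp add: rees_def UP_simps)
  show "p \<oplus>\<^bsub>UP R\<^esub> q \<in> rees"
    using pq up_add_closed ideal_closed(3)[OF I_pow_ideal] by (simp add: rees_def UP_simps)
qed

lemma fiber_map_carrier: "fiber_map ` rees = carrier F"
proof
  show "fiber_map ` rees \<subseteq> carrier F"
  proof
    fix f assume "f \<in> fiber_map ` rees"
    then obtain p where p: "p \<in> up R" "\<And>k. p k \<in> I_pow k" "f = fiber_map p" by (auto simp: rees_def)
    obtain n where "bound \<zero> n p" using p(1) by blast
    then have "{k. f k \<noteq> mI_pow k} \<subseteq> {..n}"
      unfolding p(3) fiber_map_def using coset_zero by (auto intro: leI dest: bound.bound)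
    then show "f \<in> carrier F"
      using p(2,3) finite_subset[OF _ finite_atMost] by (auto simp: fiber_ring_def fiber_map_def fiber_summand_def)
  qed
  show "carrier F \<subseteq> fiber_map ` rees"
  proof
    fix f assume f: "f \<in> carrier F"
    then have "\<exists>x. x \<in> I_pow k \<and> f k = mI_pow k +> x" for k
      by (auto simp: fiber_ring_def fiber_summand_def)
    then obtain g where g: "\<And>k. g k \<in> I_pow k" "\<And>k. f k = mI_pow k +> g k" by metis
    \<comment> \<open>The zero class must be represented by \<open>\<zero>\<close>, so that the representatives form a polynomial.\<close>
    define p where "p k = (if f k = mI_pow k then \<zero> else g k)" for k
    have "finite {k. f k \<noteq> mI_pow k}" using f by (simp add: fiber_ring_def)
    then obtain n where "{k. f k \<noteq> mI_pow k} \<subseteq> {..n}"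
      by (metis finite_nat_iff_bounded_le)
    then have "bound \<zero> n p" by (auto simp: p_def bound_def)
    moreover have pp: "p k \<in> I_pow k" for k using g(1) ideal_closed(2)[OF I_pow_ideal] by (simp add: p_def)
    ultimately have "p \<in> rees" using I_pow_carrier[OF pp] by (auto simp: rees_def intro!: mem_upI)
    moreover have "fiber_map p k = f k" for k
      using g(2)[of k] coset_zero by (cases "f k = mI_pow k") (simp_all add: fiber_map_def p_def)
    then have "fiber_map p = f" by (rule ext)
    ultimately show "f \<in> fiber_map ` rees" by blast
  qed
qed

lemma fiber_map_hom: "fiber_map \<in> ring_hom (UP R\<lparr>carrier := rees\<rparr>) F"
proof (rule ring_hom_memI)
  fix p assume "p \<in> carrier (UP R\<lparr>carrier := rees\<rparr>)"
  then show "fiber_map p \<in> carrier F" using fiber_map_carrier by auto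
next
  fix p q assume "p \<in> carrier (UP R\<lparr>carrier := rees\<rparr>)" "q \<in> carrier (UP R\<lparr>carrier := rees\<rparr>)"
  then have p: "p \<in> up R" "\<And>k. p k \<in> I_pow k" and q: "q \<in> up R" "\<And>k. q k \<in> I_pow k"
    by (auto simp: rees_def)
  have pq: "p i \<otimes> q j \<in> carrier R" for i j using I_pow_carrier p(2) q(2) by (meson m_closed)
  show "fiber_map (p \<otimes>\<^bsub>UP R\<lparr>carrier := rees\<rparr>\<^esub> q) = fiber_map p \<otimes>\<^bsub>F\<^esub> fiber_map q"
  proof
    fix n
    interpret K: ring_hom_cring R "R Quot mI_pow n" "(+>) (mI_pow n)"
      by (rule ideal.rcos_ring_hom_cring[OF mI_pow_ideal is_cring])
    have "(fiber_map p \<otimes>\<^bsub>F\<^esub> fiber_map q) n =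
        (\<Oplus>\<^bsub>R Quot mI_pow n\<^esub>i\<in>{..n}. rcoset_mult R (mI_pow n) (fiber_map p i) (fiber_map q (n - i)))"
      by (simp add: fiber_ring_def)
    also have "\<dots> = (\<Oplus>\<^bsub>R Quot mI_pow n\<^esub>i\<in>{..n}. mI_pow n +> p i \<otimes> q (n - i))"
    proof (rule K.S.finsum_cong')
      show "(\<lambda>i. mI_pow n +> p i \<otimes> q (n - i)) \<in> {..n} \<rightarrow> carrier (R Quot mI_pow n)"
        using pq by (intro Pi_I K.hom_closed)
      show "rcoset_mult R (mI_pow n) (fiber_map p i) (fiber_map q (n - i)) = mI_pow n +> p i \<otimes> q (n - i)"
        if "i \<in> {..n}" for i
        using that rcoset_mult_fiber[OF p(2) q(2), of i "n - i"] by (simp add: fiber_map_def)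
    qed simp
    also have "\<dots> = mI_pow n +> (\<Oplus>i\<in>{..n}. p i \<otimes> q (n - i))"
      using pq by (subst K.hom_finsum) (auto simp: comp_def)
    also have "\<dots> = fiber_map (p \<otimes>\<^bsub>UP R\<lparr>carrier := rees\<rparr>\<^esub> q) n"
      using p q by (simp add: fiber_map_def UP_simps)
    finally show "fiber_map (p \<otimes>\<^bsub>UP R\<lparr>carrier := rees\<rparr>\<^esub> q) n = (fiber_map p \<otimes>\<^bsub>F\<^esub> fiber_map q) n" ..
  qed
  have "(mI_pow k +> p k) <+>\<^bsub>R\<^esub> (mI_pow k +> q k) = mI_pow k +> (p k \<oplus> q k)" for k
    using ideal.a_rcos_sum[OF mI_pow_ideal I_pow_carrier[OF p(2)] I_pow_carrier[OF q(2)]] .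
  then show "fiber_map (p \<oplus>\<^bsub>UP R\<lparr>carrier := rees\<rparr>\<^esub> q) = fiber_map p \<oplus>\<^bsub>F\<^esub> fiber_map q"
    using p(1) q(1) by (simp add: fiber_map_def UP_simps fiber_ring_def)
next
  show "fiber_map \<one>\<^bsub>UP R\<lparr>carrier := rees\<rparr>\<^esub> = \<one>\<^bsub>F\<^esub>"
    by (rule ext) (simp add: fiber_map_def UP_simps fiber_ring_def coset_zero)
qed

text \<open>The ring axioms are inherited from the Rees algebra along the surjection \<open>fiber_map\<close>.\<close>

lemma ring_F: "ring F"
proof -
  have "fiber_map \<zero>\<^bsub>UP R\<^esub> = \<zero>\<^bsub>F\<^esub>"
    using coset_zero by (auto simp: fiber_map_def UP_simps fiber_ring_def)
  then have "F\<lparr>carrier := fiber_map ` rees, zero := fiber_map \<zero>\<^bsub>UP R\<^esub>\<rparr> = F"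
    unfolding fiber_map_carrier by simp
  then show ?thesis
    using ring.ring_hom_imp_img_ring[OF P.P.subring_is_ring[OF rees_subring] fiber_map_hom] by simp
qed

interpretation F: ring F by (rule ring_F)

text \<open>The class of \<open>x \<in> I\<^sup>k\<close> in degree \<open>k\<close>, obtained from the monomial \<open>x t\<^sup>k\<close> of the Rees algebra.\<close>

definition fiber_class :: "nat \<Rightarrow> 'a \<Rightarrow> nat \<Rightarrow> 'a set" where
  "fiber_class k x = fiber_map (monom (UP R) x k)"

lemma monom_rees:
  assumes "x \<in> I_pow k" shows "monom (UP R) x k \<in> rees"
proof -
  have "monom (UP R) x k \<in> up R" using P.monom_closed[OF I_pow_carrier[OF assms]] by (simp add: UP_simps)
  moreover have "monom (UP R) x k j \<in> I_pow j" for j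
    using assms I_pow_carrier ideal_closed(2)[OF I_pow_ideal] by (simp add: UP_simps)
  ultimately show ?thesis by (simp add: rees_def)
qed

lemma fiber_class_apply:
  "x \<in> I_pow k \<Longrightarrow> fiber_class k x j = (if j = k then mI_pow k +> x else mI_pow j)"
  using I_pow_carrier coset_zero by (simp add: fiber_class_def fiber_map_def UP_simps)

lemma fiber_class_piece: "fiber_piece R \<mm> I k = fiber_class k ` I_pow k"
proof
  show "fiber_class k ` I_pow k \<subseteq> fiber_piece R \<mm> I k"
    using fiber_map_carrier monom_rees
    by (auto simp: fiber_piece_def fiber_class_apply) (auto simp: fiber_class_def)
  show "fiber_piece R \<mm> I k \<subseteq> fiber_class k ` I_pow k"
  proof
    fix f assume f: "f \<in> fiber_piece R \<mm> I k"
    then have "f k \<in> fiber_summand R \<mm> I k" by (auto simp: fiber_piece_def fiber_ring_def)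
    then obtain x where "x \<in> I_pow k" "f k = mI_pow k +> x" by (auto simp: fiber_summand_def)
    then have "x \<in> I_pow k" "f j = fiber_class k x j" for j
      using f by (auto simp: fiber_class_apply fiber_piece_def)
    then have "x \<in> I_pow k" "f = fiber_class k x" by auto
    then show "f \<in> fiber_class k ` I_pow k" by blast
  qed
qed

lemma fiber_class_carrier: "x \<in> I_pow k \<Longrightarrow> fiber_class k x \<in> carrier F"
  using fiber_class_piece by (auto simp: fiber_piece_def)

lemma fiber_class_add:
  assumes "x \<in> I_pow k" "y \<in> I_pow k"
  shows "fiber_class k (x \<oplus> y) = fiber_class k x \<oplus>\<^bsub>F\<^esub> fiber_class k y"
  using ring_hom_add[OF fiber_map_hom, of "monom (UP R) x k" "monom (UP R) y k"]
    monom_rees assms P.monom_add[OF I_pow_carrier I_pow_carrier] by (simp add: fiber_class_def)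

lemma fiber_class_mult:
  assumes "x \<in> I_pow i" "y \<in> I_pow j"
  shows "fiber_class (i + j) (x \<otimes> y) = fiber_class i x \<otimes>\<^bsub>F\<^esub> fiber_class j y"
  using ring_hom_mult[OF fiber_map_hom, of "monom (UP R) x i" "monom (UP R) y j"]
    monom_rees assms P.monom_mult[OF I_pow_carrier I_pow_carrier] by (simp add: fiber_class_def)

lemma fiber_class_eq_iff:
  assumes "x \<in> I_pow k" "y \<in> I_pow k"
  shows "fiber_class k x = fiber_class k y \<longleftrightarrow> x \<ominus> y \<in> mI_pow k"
proof -
  have "fiber_class k x = fiber_class k y \<longleftrightarrow> mI_pow k +> x = mI_pow k +> y"
    using assms by (auto simp: fiber_class_apply fun_eq_iff)
  then show ?thesis using coset_eq_iff assms I_pow_carrier by blast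
qed

lemma fiber_class_zero: "fiber_class k \<zero> = \<zero>\<^bsub>F\<^esub>"
  using fiber_class_apply[OF ideal_closed(2)[OF I_pow_ideal]] coset_zero
  by (auto simp: fiber_ring_def fun_eq_iff)

lemma fiber_class_one: "fiber_class 0 \<one> = \<one>\<^bsub>F\<^esub>"
  by (auto simp: fiber_class_apply fiber_ring_def fun_eq_iff ideal_power_0)

lemma fiber_class_hom: "fiber_class 0 \<in> ring_hom R F"
  using fiber_class_carrier fiber_class_add fiber_class_mult[of _ 0 _ 0] fiber_class_one
  by (intro ring_hom_memI) (auto simp: ideal_power_0)

text \<open>The degree zero piece is \<open>R / \<mm>\<close>, so inverses come from the quotient by the maximal ideal.\<close>

lemma subfield_piece_0: "subfield (fiber_piece R \<mm> I 0) F"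
proof -
  let ?K = "fiber_class 0 ` carrier R"
  interpret h: ring_hom_ring R F "fiber_class 0"
    by (intro ring_hom_ringI2 fiber_class_hom ring_axioms ring_F)
  have sub: "subring ?K F" by (rule h.img_is_subring[OF carrier_is_subring])
  have "subcring ?K F"
  proof (rule F.subcringI[OF sub])
    fix a b assume "a \<in> ?K" "b \<in> ?K"
    then show "a \<otimes>\<^bsub>F\<^esub> b = b \<otimes>\<^bsub>F\<^esub> a" by (auto simp flip: h.hom_mult simp: m_comm)
  qed
  then have K: "cring (F\<lparr>carrier := ?K\<rparr>)" using F.subcring_iff[OF subringE(1)[OF sub]] by blast
  have eq_iff: "fiber_class 0 x = fiber_class 0 y \<longleftrightarrow> x \<ominus> y \<in> \<mm>"
    if "x \<in> carrier R" "y \<in> carrier R" for x y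
    using fiber_class_eq_iff[of x 0 y] that ideal_prod_one[OF max_ideal]
    by (simp add: fiber_kernel_def ideal_power_0)
  have one_notin: "\<one> \<notin> \<mm>"
    using ideal.one_imp_carrier[OF max_ideal] maximalideal.I_notcarr[OF maximal_m] by auto
  have "field (F\<lparr>carrier := ?K\<rparr>)"
  proof (rule cring.cring_fieldI2[OF K])
    show "\<zero>\<^bsub>F\<lparr>carrier := ?K\<rparr>\<^esub> \<noteq> \<one>\<^bsub>F\<lparr>carrier := ?K\<rparr>\<^esub>"
      using eq_iff[of \<one> \<zero>] one_notin fiber_class_zero[of 0] fiber_class_one by (auto simp: a_minus_def)
  next
    fix a assume "a \<in> carrier (F\<lparr>carrier := ?K\<rparr>)" "a \<noteq> \<zero>\<^bsub>F\<lparr>carrier := ?K\<rparr>\<^esub>"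
    then obtain x where x: "x \<in> carrier R" "a = fiber_class 0 x" "a \<noteq> fiber_class 0 \<zero>"
      by (auto simp: fiber_class_zero)
    then have "x \<notin> \<mm>" using eq_iff[of x \<zero>] by (auto simp: a_minus_def)
    then have "\<mm> +> x \<noteq> \<mm>" using ideal.rcos_const_imp_mem[OF max_ideal x(1)] by blast
    interpret Q: field "R Quot \<mm>" by (rule maximalideal.quotient_is_field[OF maximal_m is_cring])
    have "\<mm> +> x \<in> Units (R Quot \<mm>)"
      using Q.field_Units \<open>\<mm> +> x \<noteq> \<mm>\<close> ideal_closed(1)[OF max_ideal] x(1) a_rcosetsI
      by (simp add: FactRing_def)
    then obtain b where b: "b \<in> carrier (R Quot \<mm>)" "(\<mm> +> x) \<otimes>\<^bsub>R Quot \<mm>\<^esub> b = \<one>\<^bsub>R Quot \<mm>\<^esub>"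
      using Q.Units_r_inv_ex by blast
    then obtain y where y: "y \<in> carrier R" "b = \<mm> +> y"
      by (auto simp: FactRing_def A_RCOSETS_def')
    then have "\<mm> +> x \<otimes> y = \<mm> +> \<one>"
      using b(2) ideal.rcoset_mult_add[OF max_ideal x(1) y(1)] by (simp add: FactRing_def)
    then have "x \<otimes> y \<ominus> \<one> \<in> \<mm>"
      using quotient_eq_iff_same_a_r_cos[OF max_ideal, of "x \<otimes> y" \<one>] x(1) y(1) by simp
    then have "fiber_class 0 (x \<otimes> y) = fiber_class 0 \<one>"
      using x(1) y(1) by (intro iffD2[OF eq_iff]) auto
    then have "a \<otimes>\<^bsub>F\<^esub> fiber_class 0 y = \<one>\<^bsub>F\<^esub>"
      using x y(1) fiber_class_one fiber_class_mult[of x 0 y 0] by (simp add: ideal_power_0)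
    then show "\<exists>b\<in>carrier (F\<lparr>carrier := ?K\<rparr>). a \<otimes>\<^bsub>F\<lparr>carrier := ?K\<rparr>\<^esub> b = \<one>\<^bsub>F\<lparr>carrier := ?K\<rparr>\<^esub>"
      using y(1) by auto
  qed
  then have "subfield ?K F" using F.subfield_iff(1) subringE(1)[OF sub] by blast
  then show ?thesis by (simp add: fiber_class_piece ideal_power_0)
qed

text \<open>Scalars from \<open>R / \<mm>\<close> lift to \<open>R\<close>, so linear combinations of classes are classes of
  \<open>R\<close>-combinations.\<close>

lemma Span_fiber_class:
  assumes "set xs \<subseteq> I_pow k"
  shows "F.Span (fiber_piece R \<mm> I 0) (map (fiber_class k) xs) = fiber_class k ` (Idl (set xs))"
  using assms
proof (induction xs)
  case Nil
  have "Idl {} = {\<zero>}"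
    using genideal_minimal[OF zeroideal, of "{}"] ideal_closed(2)[OF genideal_ideal, of "{}"] by auto
  then show ?case by (simp add: fiber_class_zero)
next
  case (Cons x xs)
  let ?J = "Idl (set xs)"
  have x: "x \<in> I_pow k" and xs: "set xs \<subseteq> I_pow k" using Cons.prems by auto
  have J: "?J \<subseteq> I_pow k" by (rule genideal_minimal[OF I_pow_ideal xs])
  have step: "fiber_class 0 a \<otimes>\<^bsub>F\<^esub> fiber_class k x \<oplus>\<^bsub>F\<^esub> fiber_class k y = fiber_class k (a \<otimes> x \<oplus> y)"
    if "a \<in> carrier R" "y \<in> ?J" for a y
    using that J x fiber_class_mult[of a 0 x k] fiber_class_add[of "a \<otimes> x" k y]
      ideal_closed(6)[OF I_pow_ideal _ x] by (auto simp: ideal_power_0)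
  have "F.Span (fiber_piece R \<mm> I 0) (map (fiber_class k) (x # xs)) =
      {fiber_class 0 a \<otimes>\<^bsub>F\<^esub> fiber_class k x \<oplus>\<^bsub>F\<^esub> fiber_class k y | a y. a \<in> carrier R \<and> y \<in> ?J}"
    (is "?L = ?E")
  proof -
    have "u \<in> ?L \<longleftrightarrow> u \<in> ?E" for u
    proof -
      have "?L = F.line_extension (fiber_class 0 ` carrier R) (fiber_class k x) (fiber_class k ` ?J)"
        using Cons.IH[OF xs] by (simp add: fiber_class_piece[of 0] ideal_power_0)
      then show ?thesis by (simp only: F.line_extension_mem_iff) blast
    qed
    then show ?thesis by blast
  qed
  also have "\<dots> = {fiber_class k (a \<otimes> x \<oplus> y) | a y. a \<in> carrier R \<and> y \<in> ?J}"
    using step by (smt (verit) Collect_cong)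
  also have "\<dots> = fiber_class k ` {a \<otimes> x \<oplus> y | a y. a \<in> carrier R \<and> y \<in> ?J}" by blast
  also have "\<dots> = fiber_class k ` (Idl (set (x # xs)))"
  proof -
    have "set xs \<subseteq> carrier R" using xs I_pow_carrier by blast
    then show ?thesis using genideal_insert[of x "set xs"] I_pow_carrier[OF x] by simp
  qed
  finally show ?case .
qed

text \<open>From a finite generating set of \<open>I\<^sup>k\<close> inside \<open>H\<close>, whose classes span \<open>I\<^sup>k / \<mm> I\<^sup>k\<close>, select elements \<open>ys\<close>
  whose classes form a basis. By Nakayama's lemma they still generate \<open>I\<^sup>k\<close>, so \<open>\<mu>(I\<^sup>k)\<close> is at most the
  dimension. Conversely the classes of any generators span, admissible or not, so there are at least as
  many generators as the dimension.\<close>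

theorem dim_fiber_piece:
  "ring.dim F (fiber_piece R \<mm> I 0) (fiber_piece R \<mm> I k) = min_gens R (I_pow k)"
proof -
  let ?K = "fiber_piece R \<mm> I 0" and ?E = "fiber_piece R \<mm> I k"
  note K = subfield_piece_0
  obtain S where S: "S \<subseteq> H \<inter> I_pow k" "finite S" "Idl S = I_pow k" using power_generators by blast
  obtain xs where xs: "set xs = S" using S(2) finite_list by blast
  have xs_pow: "set xs \<subseteq> I_pow k" using S xs by blast
  have "set (map (fiber_class k) xs) \<subseteq> carrier F" using xs_pow fiber_class_carrier by auto
  from F.independent_sublist[OF K this]
  obtain Vs where Vs: "set Vs \<subseteq> fiber_class k ` set xs" "F.independent ?K Vs"
    "F.Span ?K Vs = F.Span ?K (map (fiber_class k) xs)" by auto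
  obtain ys where ys: "set ys \<subseteq> set xs" "Vs = map (fiber_class k) ys"
  proof -
    have "Vs \<in> map (fiber_class k) ` lists (set xs)"
      using Vs(1) unfolding lists_image[symmetric] by (simp add: lists_eq_set)
    then show ?thesis using that by (auto simp: lists_eq_set)
  qed
  have E: "F.Span ?K (map (fiber_class k) ys) = ?E"
    using Vs(3) ys(2) Span_fiber_class[OF xs_pow] S(3) xs fiber_class_piece by simp
  have ys_pow: "set ys \<subseteq> I_pow k" using ys(1) xs_pow by blast
  have Idl_ys: "Idl (set ys) \<subseteq> I_pow k" by (rule genideal_minimal[OF I_pow_ideal ys_pow])
  have "I_pow k \<subseteq> Idl (set ys) <+> mI_pow k"
  proof
    fix z assume z: "z \<in> I_pow k"
    then have "fiber_class k z \<in> fiber_class k ` (Idl (set ys))"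
      using E Span_fiber_class[OF ys_pow] fiber_class_piece[of k] by (metis imageI)
    then obtain y where y: "y \<in> Idl (set ys)" "fiber_class k z = fiber_class k y" by blast
    then have "z \<ominus> y \<in> mI_pow k" using fiber_class_eq_iff z Idl_ys by blast
    moreover have "z = y \<oplus> (z \<ominus> y)" using I_pow_carrier z y(1) Idl_ys
      by (metis a_comm a_minus_def add.inv_solve_right minus_closed subsetD)
    ultimately show "z \<in> Idl (set ys) <+> mI_pow k" using y(1) unfolding set_add_def' by blast
  qed
  then have gen: "Idl (set ys) = I_pow k"
    using ys(1) S(1) xs by (intro nakayama) (auto simp: fiber_kernel_def)
  have dim: "F.dimension (length ys) ?K ?E"
    using F.dimension_independent[OF Vs(2)] ys(2) E by simp
  have carr: "set ys \<subseteq> carrier R" using ys_pow I_pow_carrier by blast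
  have "min_gens R (I_pow k) \<le> length ys"
    using min_gens_le[OF carr _ gen] card_length[of ys] by simp
  moreover have "length ys \<le> min_gens R (I_pow k)"
  proof -
    obtain T where T: "T \<subseteq> carrier R" "finite T" "card T = min_gens R (I_pow k)" "Idl T = I_pow k"
      using min_gens_attained[OF carr _ gen] by blast
    obtain ts where ts: "set ts = T" "length ts = card T"
      using T(2) finite_distinct_list distinct_card by metis
    have ts_pow: "set ts \<subseteq> I_pow k" using ts(1) T genideal_self by blast
    have span: "F.Span ?K (map (fiber_class k) ts) = ?E"
      using Span_fiber_class[OF ts_pow] ts T(4) fiber_class_piece by simp
    have "set (map (fiber_class k) ts) \<subseteq> carrier F" using ts_pow fiber_class_carrier by auto
    from F.independent_sublist[OF K this]
    obtain Ws where Ws: "set Ws \<subseteq> set (map (fiber_class k) ts)" "F.independent ?K Ws"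
      "F.Span ?K Ws = ?E" unfolding span by blast
    have "length ys = length Ws"
      using F.dimension_is_inj[OF K dim F.dimensionI[OF K Ws(2,3)]] .
    also have "\<dots> = card (set Ws)" using F.independent_distinct[OF K Ws(2)] distinct_card by metis
    also have "\<dots> \<le> card (set (map (fiber_class k) ts))" by (rule card_mono[OF _ Ws(1)]) simp
    also have "\<dots> \<le> length ts" using card_length[of "map (fiber_class k) ts"] by simp
    finally show ?thesis using ts(2) T(3) by simp
  qed
  ultimately show ?thesis using F.dimI[OF K dim] by (simp add: over_def)
qed

lemma dim_fiber_piece_0: "ring.dim F (fiber_piece R \<mm> I 0) (fiber_piece R \<mm> I 0) = 1"
  using F.dimI[OF subfield_piece_0 F.dimension_one[OF subfield_piece_0]] by (simp add: over_def)

end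

section \<open>The two kinds of base ring\<close>

lemma nakayama_powers_local:
  fixes R (structure)
  assumes "noetherian_local_ring R \<mm>" and I: "ideal I R"
  shows "nakayama_powers R \<mm> I (carrier R)"
proof -
  interpret noetherian_local_ring R \<mm> by fact
  show ?thesis
  proof (intro nakayama_powers.intro nakayama_powers_axioms.intro)
    show "cring R" by (rule is_cring)
  next
    fix k
    have J: "ideal (ideal_power R I k) R" by (rule ideal_power_ideal[OF I])
    obtain S where S: "S \<subseteq> carrier R" "finite S" "ideal_power R I k = Idl S"
      using finetely_gen[OF J] by blast
    then show "\<exists>S\<subseteq>carrier R \<inter> ideal_power R I k. finite S \<and> Idl S = ideal_power R I k"
      using genideal_self[OF S(1)] by auto
    fix S assume "S \<subseteq> carrier R \<inter> ideal_power R I k"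
      "ideal_power R I k \<subseteq> Idl S <+> \<mm> \<cdot> ideal_power R I k"
    then show "Idl S = ideal_power R I k" using local_nakayama[OF J] by simp
  qed (fact maximal I)+
qed

lemma (in standard_graded_algebra) graded_ideal_power:
  assumes "graded_ideal R G I" shows "graded_ideal R G (ideal_power R I k)"
proof (induction k)
  case 0
  show ?case
    using oneideal component_carrier
    by (simp add: ideal_power_0 graded_ideal_iff closed_under_components_def)
next
  case (Suc k)
  then show ?case unfolding ideal_power_Suc using assms by (rule graded_ideal_prod)
qed

lemma nakayama_powers_graded:
  fixes R (structure)
  assumes "standard_graded_algebra R G" and I: "graded_ideal R G I"
  shows "nakayama_powers R (graded_maximal_ideal R G) I (standard_graded_algebra.homogeneous G)"
proof -
  interpret standard_graded_algebra R G by fact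
  interpret N: noetherian_ring R by (rule noetherian)
  show ?thesis
  proof (intro nakayama_powers.intro nakayama_powers_axioms.intro)
    show "cring R" by (rule is_cring)
  next
    fix k
    have J: "graded_ideal R G (ideal_power R I k)" by (rule graded_ideal_power[OF I])
    then have "ideal (ideal_power R I k) R" by (simp add: graded_ideal_def)
    then obtain T where "T \<subseteq> carrier R" "finite T" "ideal_power R I k = Idl T"
      using N.finetely_gen by blast
    then show "\<exists>S\<subseteq>homogeneous \<inter> ideal_power R I k. finite S \<and> Idl S = ideal_power R I k"
      using graded_ideal_homogeneous_generators[OF J] by blast
    fix S assume "S \<subseteq> homogeneous \<inter> ideal_power R I k"
      "ideal_power R I k \<subseteq> Idl S <+> graded_maximal_ideal R G \<cdot> ideal_power R I k"
    then show "Idl S = ideal_power R I k" by (rule graded_nakayama[OF J])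
  qed (use maximalideal_graded_maximal_ideal I in \<open>auto simp: graded_ideal_def\<close>)
qed

section \<open>The $h$-vector as a second difference\<close>

lemma fps_one_minus_X_squared_mult_nth:
  fixes f :: "'a :: comm_ring_1 fps"
  shows "fps_nth ((1 - fps_X)\<^sup>2 * f) (Suc (Suc n)) =
      fps_nth f (Suc (Suc n)) - 2 * fps_nth f (Suc n) + fps_nth f n"
proof -
  have "(1 - fps_X)\<^sup>2 * f = f - (fps_X * f + fps_X * f) + fps_X * (fps_X * f)"
    by (simp add: power2_eq_square algebra_simps)
  then show ?thesis
    by (simp only: fps_add_nth fps_sub_nth fps_X_mult_nth) simp
qed

text \<open>Since \<open>m 0 = 1\<close>, the line through the first two values is \<open>k (m 1 - 1) + 1\<close>. A sequence with nonnegative second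
  differences is convex and lies above this line; it agrees with the line exactly if the second
  differences vanish.\<close>

lemma second_difference_bounds:
  fixes m h :: "nat \<Rightarrow> int"
  assumes m0: "m 0 = 1"
    and h: "\<And>n. h (n + 2) = m (n + 2) - 2 * m (n + 1) + m n"
  shows "m 2 \<ge> 2 * m 1 - 1 \<longleftrightarrow> h 2 \<ge> 0"
    and "(\<forall>i. h i \<ge> 0) \<longrightarrow> (\<forall>k\<ge>1. m k \<ge> int k * (m 1 - 1) + 1)"
    and "(\<forall>k\<ge>1. m k = int k * (m 1 - 1) + 1) \<longleftrightarrow> (\<forall>i\<ge>2. h i = 0)"
proof -
  have h': "h (Suc (Suc n)) = (m (Suc (Suc n)) - m (Suc n)) - (m (Suc n) - m n)" for n
    using h[of n] by (simp add: numeral_2_eq_2)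
  show "m 2 \<ge> 2 * m 1 - 1 \<longleftrightarrow> h 2 \<ge> 0" using h[of 0] m0 by (auto simp: numeral_2_eq_2)
  show "(\<forall>i. h i \<ge> 0) \<longrightarrow> (\<forall>k\<ge>1. m k \<ge> int k * (m 1 - 1) + 1)"
  proof (intro impI allI)
    fix k assume nonneg: "\<forall>i. h i \<ge> 0"
    have step: "m (Suc n) - m n \<ge> m 1 - 1" for n
    proof (induction n)
      case (Suc n)
      then show ?case using h'[of n] spec[OF nonneg, of "Suc (Suc n)"] by simp
    qed (simp add: m0)
    show "m k \<ge> int k * (m 1 - 1) + 1"
    proof (induction k)
      case (Suc k)
      then show ?case using step[of k] by (simp add: algebra_simps)
    qed (simp add: m0)
  qed
  show "(\<forall>k\<ge>1. m k = int k * (m 1 - 1) + 1) \<longleftrightarrow> (\<forall>i\<ge>2. h i = 0)" (is "?lin \<longleftrightarrow> ?zero")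
  proof
    assume lin: ?lin
    have lin': "m k = int k * (m 1 - 1) + 1" for k using spec[OF lin, of k] m0 by (cases "k = 0") simp_all
    show ?zero
    proof (intro allI impI)
      fix i :: nat assume "i \<ge> 2"
      then obtain n where "i = n + 2" by (metis add.commute le_Suc_ex)
      then show "h i = 0" using h[of n] lin'[of "n + 2"] lin'[of "n + 1"] lin'[of n]
        by (simp add: algebra_simps)
    qed
  next
    assume zero: ?zero
    have step: "m (Suc n) - m n = m 1 - 1" for n
    proof (induction n)
      case (Suc n)
      then show ?case using h'[of n] spec[OF zero, of "Suc (Suc n)"] by simp
    qed (simp add: m0)
    have "m k = int k * (m 1 - 1) + 1" for k
    proof (induction k)
      case (Suc k)
      then show ?case using step[of k] by (simp add: algebra_simps)
    qed (simp add: m0)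
    then show ?lin by blast
  qed
qed

theorem proposition2p1:
  fixes R :: "('a, 'b) ring_scheme" and \<mm> I :: "'a set"
  assumes base: "(noetherian_local_ring R \<mm> \<and> ideal I R) \<or>
      (\<exists>G. standard_graded_algebra R G \<and> \<mm> = graded_maximal_ideal R G \<and> graded_ideal R G I)"
    and proper: "I \<noteq> carrier R"
    and spread: "analytic_spread R \<mm> I = 2"
  shows "let \<mu> = (\<lambda>L. int (min_gens R L));
             h = h_vector (fiber_ring R \<mm> I) (fiber_piece R \<mm> I)
         in (\<mu> (ideal_power R I 2) \<ge> 2 * \<mu> I - 1 \<longleftrightarrow> h 2 \<ge> 0) \<and>
            ((\<forall>i. h i \<ge> 0) \<longrightarrow>
               (\<forall>k\<ge>1. \<mu> (ideal_power R I k) \<ge> int k * (\<mu> I - 1) + 1)) \<and>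
            ((\<forall>k\<ge>1. \<mu> (ideal_power R I k) = int k * (\<mu> I - 1) + 1) \<longleftrightarrow>
               (\<forall>i\<ge>2. h i = 0))"
proof -
  obtain H where "nakayama_powers R \<mm> I H"
    using base nakayama_powers_local nakayama_powers_graded by blast
  then interpret nakayama_powers R \<mm> I H .
  define m where "m k = int (min_gens R (ideal_power R I k))" for k
  define h where "h = h_vector (fiber_ring R \<mm> I) (fiber_piece R \<mm> I)"
  have m1: "m 1 = int (min_gens R I)" unfolding m_def by (simp add: ideal_power_1[OF ideal_I] del: One_nat_def)
  have m0: "m 0 = 1" unfolding m_def using dim_fiber_piece[of 0] dim_fiber_piece_0 by simp
  \<comment> \<open>Analytic spread two makes the exponent of \<open>1 - t\<close> two, which turns \<open>h\<close> into a second difference.\<close>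
  have "krull_dim (fiber_ring R \<mm> I) = enat 2"
    using spread by (simp add: analytic_spread_def numeral_eq_enat)
  then have "h i = fps_nth ((1 - fps_X)\<^sup>2 * Abs_fps m) i" for i
    unfolding h_def h_vector_def hilbert_series_def dim_fiber_piece m_def[symmetric] by simp
  then have "h (n + 2) = m (n + 2) - 2 * m (n + 1) + m n" for n
    by (simp add: fps_one_minus_X_squared_mult_nth)
  from second_difference_bounds[of m h, OF m0 this] show ?thesis
    unfolding Let_def h_def[symmetric] m1[symmetric] m_def[symmetric] by blast
qed

end
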